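(* Let $\rho\in(0,1/4)$. Then for Lebesgue almost every $\lambda \in(0,\rho)\cup\left(\frac{1-2\rho}{2},\frac{1-\rho}{2}\right)$ we have $$\dim_H U_\lambda=\dim_H E_\lambda=\frac{ \log 4}{-\log \rho}.$$ In particular, if $\rho\in(0,1/16)$, then $U_\lambda=E_\lambda$ for Lebesgue almost every $\lambda\in(0,\rho)\cup\left(\frac{1-2\rho}{2},\frac{1-\rho}{2}\right)$.
   Context: Let $\Omega_\lambda:=\{0,\lambda,1-\rho-\lambda,1-\rho\}$ and $f_d(x):=\rho x+d$ for $d\in\Omega_\lambda$. $E_\lambda$ is the self-similar set of the iterated function system $\{f_d:d\in\Omega_\lambda\}$, i.e. the unique nonempty compact set with $E_\lambda=\bigcup_{d\in\Omega_\lambda}f_d(E_\lambda)$. The coding map is $\pi_\lambda:\Omega_\lambda^{\mathbb N}\to E_\lambda$, $\pi_\lambda((d_i))=\sum_{i=1}^\infty\rho^{i-1}d_i$, and $U_\lambda:=\{x\in E_\lambda:\#\pi_\lambda^{-1}(x)=1\}$ is the set of points with a unique coding. $\dim_H$ is Hausdorff dimension. *)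

theory Defs
  imports "HOL-Analysis.Analysis"
begin

section \<open>Hausdorff measure and dimension\<close>

text \<open>
  The contribution of a covering set to the s-dimensional Hausdorff sum, with the usual
  convention that every nonempty set contributes 1 for s = 0 and the empty set contributes 0.
  The case s = 0 is separate because \<^term>\<open>0 powr 0 = (0::real)\<close>.
\<close>
definition diam_pow :: "real \<Rightarrow> 'a::metric_space set \<Rightarrow> ennreal" where
  "diam_pow s A =
     (if A = {} then 0 else if s = 0 then 1 else ennreal (diameter A powr s))"

text \<open>
  Boundedness of the covering sets is required explicitly, since \<^const>\<open>diameter\<close> is
  real-valued and meaningless on unbounded sets. Since covering sets may be empty,
  finite covers are included.
\<close>
definition hausdorff_premeasure :: "real \<Rightarrow> real \<Rightarrow> 'a::metric_space set \<Rightarrow> ennreal" where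
  "hausdorff_premeasure s \<delta> A =
     Inf {(\<Sum>i. diam_pow s (C i)) | C :: nat \<Rightarrow> 'a set.
            A \<subseteq> (\<Union>i. C i) \<and> (\<forall>i. bounded (C i) \<and> diameter (C i) \<le> \<delta>)}"

definition hausdorff_measure :: "real \<Rightarrow> 'a::metric_space set \<Rightarrow> ennreal" where
  "hausdorff_measure s A = (SUP \<delta>\<in>{0<..}. hausdorff_premeasure s \<delta> A)"

definition hausdorff_dim :: "'a::metric_space set \<Rightarrow> ennreal" where
  "hausdorff_dim A = Inf {ennreal s | s. 0 \<le> s \<and> hausdorff_measure s A = 0}"

section \<open>The self-similar set and its unique codings\<close>

definition digits :: "real \<Rightarrow> real \<Rightarrow> real set" where
  "digits \<rho> lam = {0, lam, 1 - \<rho> - lam, 1 - \<rho>}"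

definition ifs_map :: "real \<Rightarrow> real \<Rightarrow> real \<Rightarrow> real" where
  "ifs_map \<rho> d x = \<rho> * x + d"

text \<open>For \<open>0 < \<rho> < 1\<close> there is exactly one such set.\<close>
definition self_similar_set :: "real \<Rightarrow> real \<Rightarrow> real set" where
  "self_similar_set \<rho> lam =
     (THE K. K \<noteq> {} \<and> compact K \<and> K = (\<Union>d\<in>digits \<rho> lam. ifs_map \<rho> d ` K))"

text \<open>
  Sequences are indexed from 0, so the exponent \<open>i - 1\<close> for positive indices becomes \<open>i\<close>.
\<close>
definition coding_map :: "real \<Rightarrow> (nat \<Rightarrow> real) \<Rightarrow> real" where
  "coding_map \<rho> d = (\<Sum>i. \<rho> ^ i * d i)"

definition codings :: "real \<Rightarrow> real \<Rightarrow> real \<Rightarrow> (nat \<Rightarrow> real) set" where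
  "codings \<rho> lam x = {d. (\<forall>i. d i \<in> digits \<rho> lam) \<and> coding_map \<rho> d = x}"

definition unique_coding_set :: "real \<Rightarrow> real \<Rightarrow> real set" where
  "unique_coding_set \<rho> lam = {x \<in> self_similar_set \<rho> lam. card (codings \<rho> lam x) = 1}"

end

theory Submission
  imports Defs "HOL-Probability.Probability"
begin

text \<open>
  For two symbolic sequences with distinct first symbols, the difference of the points they code is
  affine in \<open>lam\<close> and either has slope at least \<open>1/3\<close> or is bounded away from \<open>0\<close>; so the parameters for
  which the two points are \<open>r\<close>-close form a set inside an interval of length \<open>6 r\<close>. This holds for all
  \<open>lam\<close> in \<open>(0, 1 - \<rho>)\<close>.

  Fix a sequence \<open>w\<close>. At level \<open>m\<close> there are \<open>4 ^ m\<close> competing words, each excluding an interval of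
  length of order \<open>\<rho> ^ m\<close>. As \<open>4 \<rho> < 1\<close>, almost every \<open>lam\<close> makes \<open>w\<close> a unique coding. If \<open>16 \<rho> < 1\<close>, the same
  count over pairs of words shows that the coding map is injective for almost every \<open>lam\<close>.

  For \<open>\<theta> < 1\<close>, transversality bounds the integral over \<open>lam\<close> of the mass that the projected Bernoulli
  measure gives to the ball of radius \<open>\<rho> ^ n\<close> around the point coded by \<open>w\<close> by a multiple of \<open>4 ^ -n\<close>;
  hence this mass is \<open>O((4 \<theta>) ^ -n)\<close> for almost every \<open>lam\<close>. By Fubini both statements hold, for
  almost every \<open>lam\<close>, at almost every \<open>w\<close>, and the mass distribution principle gives dimension at least
  \<open>ln (4 \<theta>) / - ln \<rho>\<close> for the set of points with a unique coding.
\<close>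

section \<open>Hausdorff dimension and exceptional parameters\<close>

lemma hausdorff_dim_mono:
  assumes "A \<subseteq> B"
  shows "hausdorff_dim A \<le> hausdorff_dim B"
proof -
  have "hausdorff_premeasure s \<delta> A \<le> hausdorff_premeasure s \<delta> B" for s \<delta>
    unfolding hausdorff_premeasure_def
    using assms by (intro Inf_superset_mono Collect_mono ex_mono impI conj_mono) auto
  then have "hausdorff_measure s A \<le> hausdorff_measure s B" for s
    unfolding hausdorff_measure_def by (rule SUP_subset_mono[OF order_refl])
  then have "hausdorff_measure s A = 0" if "hausdorff_measure s B = 0" for s
    using that by (metis le_zero_eq)
  then show ?thesis
    unfolding hausdorff_dim_def by (intro Inf_superset_mono) auto
qed

lemma power_powr_commute:
  assumes "(0::real) < x" shows "(x ^ n) powr a = (x powr a) ^ n"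
  using assms by (simp add: powr_def ln_realpow exp_of_nat_mult[symmetric] mult_ac)

text \<open>Mass distribution principle for the image of \<open>M\<close> under \<open>f\<close>.
  The constant may depend on \<open>w\<close>, so the points are sorted by an integer bound into
  countably many sets \<open>G K\<close>. If \<open>t < s\<close> and the \<open>t\<close>-measure
  of \<open>A\<close> vanished, covers of \<open>A\<close> with small \<open>t\<close>-sum would
  give covers of \<open>G K\<close> of small mass. As \<open>A\<close> is arbitrary,
  \<open>G K\<close> may fail to be measurable; it is therefore enclosed in measurable sets.\<close>

lemma hausdorff_dim_ge_mass_distribution:
  fixes f :: "'b \<Rightarrow> 'a::metric_space"
  assumes M: "prob_space M" and f[measurable]: "f \<in> M \<rightarrow>\<^sub>M borel"
    and r: "0 < r" "r < 1" and s: "0 < s"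
    and AE: "AE w in M. f w \<in> A \<and>
      (\<exists>K. \<forall>n. emeasure M {v \<in> space M. dist (f w) (f v) \<le> r ^ n} \<le> ennreal (K * (r powr s) ^ n))"
  shows "ennreal s \<le> hausdorff_dim A"
proof -
  interpret prob_space M by fact
  define B where "B w \<delta> = {v \<in> space M. dist (f w) (f v) \<le> \<delta>}" for w \<delta>
  have B_sets[measurable]: "B w \<delta> \<in> sets M" for w \<delta>
  proof -
    have "B w \<delta> = f -` cball (f w) \<delta> \<inter> space M" by (auto simp: B_def)
    then show ?thesis by simp
  qed
  define G where "G K = {w \<in> space M. f w \<in> A \<and> (\<forall>n. emeasure M (B w (r ^ n)) \<le> ennreal (real K * (r powr s) ^ n))}"
    for K :: nat
  define q where "q = r powr s"
  have q: "0 < q" "q < 1"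
    using r s powr_less_mono2[of s r 1] by (auto simp: q_def)
  \<comment> \<open>Passing from the radii \<open>r ^ n\<close> to all radii up to 1 costs the
    factor \<open>1 / q\<close>.\<close>
  have ball_le: "emeasure M (B w \<delta>) \<le> ennreal (real K / q) * ennreal (\<delta> powr s)"
    if w: "w \<in> G K" and \<delta>: "0 \<le> \<delta>" "\<delta> \<le> 1" for w K \<delta>
  proof (cases "\<delta> = 0")
    \<comment> \<open>Radius 0 comes from one-point covering sets; the ball then has mass 0, as the
      limit of the bounds at the radii \<open>r ^ n\<close>.\<close>
    case True
    have "emeasure M (B w \<delta>) \<le> ennreal (real K * q ^ n)" for n
    proof -
      have "r ^ n \<ge> 0" using r by simp
      then have "B w \<delta> \<subseteq> B w (r ^ n)" using True unfolding B_def by auto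
      then have "emeasure M (B w \<delta>) \<le> emeasure M (B w (r ^ n))"
        by (rule emeasure_mono) simp
      also have "\<dots> \<le> ennreal (real K * q ^ n)" using w by (simp add: G_def q_def)
      finally show ?thesis .
    qed
    moreover have "(\<lambda>n. ennreal (real K * q ^ n)) \<longlonglongrightarrow> ennreal (real K * 0)"
      using q by (intro tendsto_ennrealI tendsto_mult tendsto_const LIMSEQ_power_zero) auto
    ultimately have "emeasure M (B w \<delta>) \<le> 0"
      by (intro LIMSEQ_le_const[where X = "\<lambda>n. ennreal (real K * q ^ n)"]) auto
    then show ?thesis by simp
  next
    case False
    with \<delta> have "\<delta> > 0" by simp
    then obtain n0 where "r ^ n0 < \<delta>"
      using real_arch_pow_inv r by blast
    \<comment> \<open>With the least such \<open>n\<close>, the preceding power is still at least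
      \<delta>; it exists because \<delta> \<le> 1 rules out \<open>n = 0\<close>.\<close>
    define n where "n = (LEAST n. r ^ n < \<delta>)"
    have n: "r ^ n < \<delta>" unfolding n_def by (rule LeastI) fact
    with \<delta> have "n \<noteq> 0" by (metis power_0 linorder_not_less)
    then obtain m where m: "n = Suc m" using not0_implies_Suc by blast
    have "\<not> r ^ m < \<delta>" using not_less_Least[of m "\<lambda>n. r ^ n < \<delta>"] m unfolding n_def by auto
    then have "emeasure M (B w \<delta>) \<le> emeasure M (B w (r ^ m))"
      by (intro emeasure_mono B_sets) (auto simp: B_def)
    also have "\<dots> \<le> ennreal (real K * q ^ m)"
      using w by (auto simp: G_def q_def)
    also have "\<dots> \<le> ennreal (real K / q * \<delta> powr s)"
    proof (rule ennreal_leI)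
      have "q ^ m = q ^ n / q" using q m by simp
      also have "q ^ n = (r ^ n) powr s"
        using r by (simp add: q_def power_powr_commute)
      also have "\<dots> / q \<le> \<delta> powr s / q"
        using n r s q by (intro divide_right_mono powr_mono2) auto
      finally have "real K * q ^ m \<le> real K * (\<delta> powr s / q)"
        by (rule mult_left_mono) simp
      then show "real K * q ^ m \<le> real K / q * \<delta> powr s" by simp
    qed
    also have "\<dots> = ennreal (real K / q) * ennreal (\<delta> powr s)"
      using q by (intro ennreal_mult) auto
    finally show ?thesis .
  qed
  have "s \<le> t" if t: "0 \<le> t" and H: "hausdorff_measure t A = 0" for t
  proof (rule ccontr)
    assume "\<not> s \<le> t"
    then have ts: "t < s" by simp
    \<comment> \<open>Scale 1 suffices, since \<open>ball_le\<close> handles every radius up to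
      1.\<close>
    have "hausdorff_premeasure t 1 A \<le> hausdorff_measure t A"
      unfolding hausdorff_measure_def by (rule SUP_upper) simp
    then have pre: "hausdorff_premeasure t 1 A = 0" using H by simp
    have cover: "\<exists>N\<in>sets M. G K \<subseteq> N \<and> emeasure M N \<le> ennreal (real K / q) * ennreal e" if e: "e > 0" for K e
    proof -
      have "hausdorff_premeasure t 1 A < ennreal e" using pre e by simp
      then obtain C where C: "A \<subseteq> (\<Union>i::nat. C i)" "\<And>i. bounded (C i)" "\<And>i. diameter (C i) \<le> 1"
        and Ce: "(\<Sum>i. diam_pow t (C i)) < ennreal e"
        unfolding hausdorff_premeasure_def Inf_less_iff by auto
      \<comment> \<open>Centred at a chosen point of \<open>G K\<close> that maps into
        \<open>C i\<close>, the ball of radius \<open>diameter (C i)\<close> contains all points of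
        \<open>G K\<close> that map into \<open>C i\<close>.\<close>
      define N where "N i = (if C i \<inter> f ` G K = {} then {}
          else B (SOME w. w \<in> G K \<and> f w \<in> C i) (diameter (C i)))" for i
      have N_sets: "range N \<subseteq> sets M" by (auto simp: N_def)
      have some: "(SOME w. w \<in> G K \<and> f w \<in> C i) \<in> G K \<and> f (SOME w. w \<in> G K \<and> f w \<in> C i) \<in> C i"
        if "C i \<inter> f ` G K \<noteq> {}" for i
        by (rule someI_ex) (use that in blast)
      have "G K \<subseteq> (\<Union>i. N i)"
      proof
        fix w assume w: "w \<in> G K"
        then have "f w \<in> A" by (simp add: G_def)
        then obtain i where i: "f w \<in> C i" using C by blast
        with w have ne: "C i \<inter> f ` G K \<noteq> {}" by blast
        from some[OF ne] have "w \<in> N i"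
          using i w ne diameter_bounded_bound[OF C(2)] by (auto simp: N_def B_def G_def)
        then show "w \<in> (\<Union>i. N i)" by blast
      qed
      moreover have "emeasure M (\<Union>i. N i) \<le> ennreal (real K / q) * ennreal e"
      proof -
        have "emeasure M (N i) \<le> ennreal (real K / q) * diam_pow t (C i)" for i
        proof (cases "C i \<inter> f ` G K = {}")
          case True then show ?thesis by (simp add: N_def)
        next
          case False
          have d: "0 \<le> diameter (C i)" "diameter (C i) \<le> 1"
            using C diameter_ge_0 by blast+
          have "emeasure M (N i) \<le> ennreal (real K / q) * ennreal (diameter (C i) powr s)"
            using ball_le[OF conjunct1[OF some[OF False]] d] False by (simp add: N_def)
          also have "ennreal (diameter (C i) powr s) \<le> diam_pow t (C i)"
          proof -
            \<comment> \<open>Diameters are at most 1, so lowering the exponent from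
              \<open>s\<close> to \<open>t\<close> increases the power; for \<open>t = 0\<close> the
              comparison is with the value 1 of \<open>diam_pow\<close>.\<close>
            have "diameter (C i) powr s \<le> diameter (C i) powr t" if "t \<noteq> 0"
              using d ts by (intro powr_mono') auto
            moreover have "diameter (C i) powr s \<le> 1"
              using d s powr_mono2[of s "diameter (C i)" 1] by simp
            ultimately show ?thesis
              using False by (auto simp: diam_pow_def intro!: ennreal_leI)
          qed
          finally show ?thesis by (simp add: mult_left_mono)
        qed
        then have "(\<Sum>i. emeasure M (N i)) \<le> (\<Sum>i. ennreal (real K / q) * diam_pow t (C i))"
          by (intro suminf_le) auto
        also have "\<dots> = ennreal (real K / q) * (\<Sum>i. diam_pow t (C i))" by simp
        also have "\<dots> \<le> ennreal (real K / q) * ennreal e"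
          using Ce by (intro mult_left_mono) auto
        finally show ?thesis
          using emeasure_subadditive_countably[OF N_sets] by (rule order.trans[rotated])
      qed
      moreover have "(\<Union>i. N i) \<in> sets M" using N_sets by auto
      ultimately show ?thesis by blast
    qed
    have "AE w in M. w \<notin> G K" for K
    proof -
      define c where "c = real K / q"
      have c: "c \<ge> 0" using q by (simp add: c_def)
      \<comment> \<open>Covers of mass of order \<open>(1 / 2) ^ j\<close> are intersected to a
        measurable null set containing \<open>G K\<close>.\<close>
      have "\<exists>N. N \<in> sets M \<and> G K \<subseteq> N \<and> emeasure M N \<le> ennreal (c * (1 / 2) ^ j)" for j :: nat
        using cover[of "(1 / 2) ^ j" K] c
        by (auto simp: c_def[symmetric] ennreal_mult)
      then obtain N where N: "\<And>j::nat. N j \<in> sets M" "\<And>j. G K \<subseteq> N j"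
        "\<And>j. emeasure M (N j) \<le> ennreal (c * (1 / 2) ^ j)" by metis
      have "emeasure M (\<Inter>j. N j) \<le> ennreal (c * (1 / 2) ^ j)" for j
        using emeasure_mono[of "\<Inter>j. N j" "N j" M] N(1,3)[of j] by (meson INF_lower UNIV_I order.trans)
      moreover have "(\<lambda>j. ennreal (c * (1 / 2) ^ j)) \<longlonglongrightarrow> ennreal (c * 0)"
        by (intro tendsto_ennrealI tendsto_mult tendsto_const LIMSEQ_power_zero) auto
      ultimately have "emeasure M (\<Inter>j. N j) \<le> 0"
        by (intro LIMSEQ_le_const[where X = "\<lambda>j. ennreal (c * (1 / 2) ^ j)"]) auto
      then have "(\<Inter>j. N j) \<in> null_sets M" using N by (auto simp: null_sets_def)
      then show ?thesis by (rule AE_I') (use N in auto)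
    qed
    then have "AE w in M. \<forall>K. w \<notin> G K" by (simp add: AE_all_countable)
    with AE have "AE w in M. False"
      using AE_space
    proof eventually_elim
      case (elim w)
      then obtain K where K: "\<And>n. emeasure M (B w (r ^ n)) \<le> ennreal (K * (r powr s) ^ n)"
        by (auto simp: B_def)
      have "emeasure M (B w (r ^ n)) \<le> ennreal (real (nat \<lceil>K\<rceil>) * (r powr s) ^ n)" for n
        by (rule order.trans[OF K]) (auto intro!: ennreal_leI mult_right_mono simp: of_nat_ceiling)
      with elim show ?case by (auto simp: G_def)
    qed
    then show False by simp
  qed
  then show ?thesis
    unfolding hausdorff_dim_def by (auto intro!: Inf_greatest ennreal_leI)
qed

text \<open>The \<open>t\<close>-sum of the cover at level \<open>n\<close> is at most
  \<open>(N * r powr t) ^ n\<close>, and the base is below 1 exactly when \<open>t\<close> exceeds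
  the claimed bound.\<close>

lemma hausdorff_dim_le_cover:
  fixes A :: "'a::metric_space set"
  assumes r: "0 < r" "r < 1" and N: "1 \<le> N"
    and cover: "\<And>n. \<exists>F. finite F \<and> card F \<le> N ^ n \<and> A \<subseteq> \<Union>F \<and> (\<forall>C\<in>F. bounded C \<and> diameter C \<le> r ^ n)"
  shows "hausdorff_dim A \<le> ennreal (ln (real N) / (- ln r))"
proof -
  define s where "s = ln (real N) / (- ln r)"
  have s: "0 \<le> s" using r N by (auto simp: s_def intro!: divide_nonneg_neg)
  have H: "hausdorff_measure t A = 0" if t: "s < t" for t
  proof -
    define q where "q = real N * r powr t"
    have "ln (real N) + t * ln r < 0"
      using t r by (simp add: s_def field_simps)
    then have "exp (ln (real N) + t * ln r) < 1" by simp
    then have q: "0 < q" "q < 1"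
      using r N by (auto simp: q_def exp_add powr_def)
    have "hausdorff_premeasure t \<delta> A \<le> ennreal (q ^ n)" if n: "r ^ n \<le> \<delta>" for \<delta> n
    proof -
      from cover[of n] obtain F where F: "finite F" "card F \<le> N ^ n" "A \<subseteq> \<Union>F"
        "\<And>C. C \<in> F \<Longrightarrow> bounded C" "\<And>C. C \<in> F \<Longrightarrow> diameter C \<le> r ^ n" by blast
      obtain h where h: "bij_betw h {0..<card F} F"
        using ex_bij_betw_nat_finite[OF F(1)] by blast
      \<comment> \<open>The finite cover is padded with empty sets, to which \<open>diam_pow\<close>
        assigns 0.\<close>
      define C where "C i = (if i < card F then h i else {})" for i
      have CF: "C i \<in> F" if "i < card F" for i
        using h that by (auto simp: C_def bij_betw_def)
      have "\<delta> \<ge> 0" using n r by (meson order.trans zero_le_power less_imp_le)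
      then have Cb: "bounded (C i) \<and> diameter (C i) \<le> \<delta>" for i
        using CF[of i] F n by (cases "i < card F") (force simp: C_def)+
      have AC: "A \<subseteq> (\<Union>i. C i)"
      proof
        fix x assume "x \<in> A"
        then obtain D where D: "D \<in> F" "x \<in> D" using F by blast
        then have "D \<in> h ` {0..<card F}" using bij_betw_imp_surj_on[OF h] by blast
        then obtain i where "i < card F" "h i = D" by auto
        then have "C i = D" by (simp add: C_def)
        with D show "x \<in> (\<Union>i. C i)" by blast
      qed
      have "hausdorff_premeasure t \<delta> A \<le> (\<Sum>i. diam_pow t (C i))"
        unfolding hausdorff_premeasure_def by (rule Inf_lower, rule CollectI, rule exI[of _ C]) (simp add: AC Cb)
      also have "\<dots> = (\<Sum>i<card F. diam_pow t (C i))"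
        by (intro suminf_finite) (auto simp: C_def diam_pow_def)
      also have "\<dots> \<le> (\<Sum>i<card F. ennreal ((r ^ n) powr t))"
      proof (intro sum_mono)
        fix i assume "i \<in> {..<card F}"
        then have "diameter (C i) \<le> r ^ n" "diameter (C i) \<ge> 0"
          using CF[of i] F(4,5)[of "C i"] diameter_ge_0[of "C i"] by auto
        then have "diameter (C i) powr t \<le> (r ^ n) powr t"
          using t s by (intro powr_mono2) auto
        then show "diam_pow t (C i) \<le> ennreal ((r ^ n) powr t)"
          using s t by (auto simp: diam_pow_def intro!: ennreal_leI)
      qed
      also have "\<dots> = ennreal (real (card F) * (r ^ n) powr t)"
        by (simp add: ennreal_mult ennreal_of_nat_eq_real_of_nat)
      also have "\<dots> \<le> ennreal (real (N ^ n) * (r ^ n) powr t)"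
        using F(2) by (intro ennreal_leI mult_right_mono) (auto simp flip: of_nat_power)
      also have "real (N ^ n) * (r ^ n) powr t = q ^ n"
        using r by (simp add: q_def power_powr_commute power_mult_distrib)
      finally show ?thesis .
    qed
    note pre = this
    have "hausdorff_premeasure t \<delta> A \<le> 0" if \<delta>: "\<delta> > 0" for \<delta>
    proof (rule LIMSEQ_le_const)
      show "(\<lambda>n. ennreal (q ^ n)) \<longlonglongrightarrow> 0"
        using q tendsto_ennrealI[OF LIMSEQ_power_zero[of q]] by simp
      obtain n0 where n0: "r ^ n0 < \<delta>" using real_arch_pow_inv[OF \<delta> r(2)] by blast
      have "r ^ n \<le> \<delta>" if "n \<ge> n0" for n
        using n0 power_decreasing[OF that, of r] r by linarith
      then show "\<exists>N. \<forall>n\<ge>N. hausdorff_premeasure t \<delta> A \<le> ennreal (q ^ n)"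
        using pre by blast
    qed
    then show ?thesis
      unfolding hausdorff_measure_def by (auto simp: SUP_eq_iff intro!: antisym SUP_least)
  qed
  \<comment> \<open>The measure is known to vanish only for \<open>t > s\<close>, so
    \<open>s\<close> is approached from above.\<close>
  have le: "hausdorff_dim A \<le> ennreal t" if "s < t" for t
    unfolding hausdorff_dim_def using that s H by (intro Inf_lower) (auto intro!: exI[of _ t])
  have "(\<lambda>n. ennreal (s + 1 / real (Suc n))) \<longlonglongrightarrow> ennreal (s + 0)"
    by (intro tendsto_ennrealI tendsto_add tendsto_const LIMSEQ_Suc[OF lim_1_over_n])
  then have "hausdorff_dim A \<le> ennreal (s + 0)"
    by (rule LIMSEQ_le_const) (auto intro!: le)
  then show ?thesis by (simp add: s_def)
qed

section \<open>Null sets of exceptional parameters\<close>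

text \<open>A parameter that is hit at every level \<open>m\<close> lies in the intersection of the
  unions \<open>T m\<close>. The measure of \<open>T m\<close> is at most
  \<open>2 * card (F m) * r m\<close>, so convergence to 0 makes the intersection null, without
  summability over the levels.\<close>

lemma AE_escape_finite_covers:
  fixes r :: "nat \<Rightarrow> real"
  assumes fin: "\<And>m. finite (F m)" and r: "\<And>m. 0 \<le> r m"
    and sub: "\<And>m p. p \<in> F m \<Longrightarrow> \<exists>c. S m p \<subseteq> {c - r m..c + r m}"
    and lim: "(\<lambda>m. real (card (F m)) * r m) \<longlonglongrightarrow> 0"
  shows "AE x in lborel. \<exists>m. \<forall>p\<in>F m. x \<notin> S m p"
proof -
  define c where "c m p = (SOME c. S m p \<subseteq> {c - r m..c + r m})" for m p
  have c: "S m p \<subseteq> {c m p - r m..c m p + r m}" if "p \<in> F m" for m p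
    unfolding c_def by (rule someI_ex[OF sub[OF that]])
  define T where "T m = (\<Union>p\<in>F m. {c m p - r m..c m p + r m})" for m
  have T[measurable]: "T m \<in> sets lborel" for m
    using fin by (auto simp: T_def intro!: sets.finite_UN)
  have le: "emeasure lborel (T m) \<le> ennreal (2 * (real (card (F m)) * r m))" for m
  proof -
    have "emeasure lborel (T m) \<le> (\<Sum>p\<in>F m. emeasure lborel {c m p - r m..c m p + r m})"
      unfolding T_def using fin by (intro emeasure_subadditive_finite) auto
    also have "\<dots> = (\<Sum>p\<in>F m. ennreal (2 * r m))"
      using r by (intro sum.cong refl) (simp add: emeasure_lborel_Icc_eq)
    also have "\<dots> = ennreal (2 * (real (card (F m)) * r m))"
      using r by (simp add: ennreal_of_nat_eq_real_of_nat ennreal_mult[symmetric] mult_ac)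
    finally show ?thesis .
  qed
  have "emeasure lborel (\<Inter>m. T m) \<le> ennreal (2 * (real (card (F m)) * r m))" for m
    using emeasure_mono[of "\<Inter>m. T m" "T m" lborel] le[of m] T by (meson INF_lower UNIV_I order.trans)
  moreover have "(\<lambda>m. ennreal (2 * (real (card (F m)) * r m))) \<longlonglongrightarrow> ennreal (2 * 0)"
    by (intro tendsto_ennrealI tendsto_mult tendsto_const lim)
  ultimately have "emeasure lborel (\<Inter>m. T m) \<le> 0"
    by (intro LIMSEQ_le_const[where X = "\<lambda>m. ennreal (2 * (real (card (F m)) * r m))"]) auto
  moreover have "(\<Inter>m. T m) \<in> sets lborel" using T by auto
  ultimately have "(\<Inter>m. T m) \<in> null_sets lborel" by (simp add: null_sets_def)
  then show ?thesis
  proof (rule AE_I')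
    show "{x \<in> space lborel. \<not> (\<exists>m. \<forall>p\<in>F m. x \<notin> S m p)} \<subseteq> (\<Inter>m. T m)"
    proof clarify
      fix x m assume "\<nexists>m. \<forall>p\<in>F m. x \<notin> S m p"
      then obtain p where "p \<in> F m" "x \<in> S m p" by blast
      then show "x \<in> T m" using c[of p m] unfolding T_def by blast
    qed
  qed
qed

section \<open>Symbolic coding\<close>

text \<open>
  The pair \<open>(p, q)\<close> encodes the digit \<open>p lam\<close>, reflected by \<open>x \<mapsto> 1 - \<rho> - x\<close> if \<open>q\<close> holds. Symbols rather
  than real digits are used because the digits depend on the parameter; \<open>slope\<close> is the derivative
  of a digit in \<open>lam\<close>.
\<close>
definition digit :: "real \<Rightarrow> real \<Rightarrow> bool \<times> bool \<Rightarrow> real" where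
  "digit \<rho> lam s = (if snd s then 1 - \<rho> - of_bool (fst s) * lam else of_bool (fst s) * lam)"

definition slope :: "bool \<times> bool \<Rightarrow> real" where
  "slope s = (if snd s then - of_bool (fst s) else of_bool (fst s))"

definition point :: "real \<Rightarrow> real \<Rightarrow> (nat \<Rightarrow> bool \<times> bool) \<Rightarrow> real" where
  "point \<rho> lam w = coding_map \<rho> (\<lambda>i. digit \<rho> lam (w i))"

text \<open>Finite words are kept as sequences padded with the symbol of the digit 0, so that
  \<open>point\<close> applies to them directly.\<close>

definition truncate :: "nat \<Rightarrow> (nat \<Rightarrow> bool \<times> bool) \<Rightarrow> nat \<Rightarrow> bool \<times> bool" where
  "truncate m w i = (if i < m then w i else (False, False))"

lemma range_digit: "range (digit \<rho> lam) = digits \<rho> lam"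
  by (auto simp: digits_def digit_def UNIV_Times_UNIV[symmetric] UNIV_bool simp del: UNIV_Times_UNIV)

lemma finite_range_truncate: "finite (range (truncate m))" (is ?fin)
  and card_range_truncate: "card (range (truncate m)) \<le> 4 ^ m" (is ?card)
proof -
  let ?P = "PiE {..<m} (\<lambda>_. UNIV :: (bool \<times> bool) set)"
  have sub: "range (truncate m) \<subseteq> truncate m ` ?P"
  proof
    fix x assume "x \<in> range (truncate m)"
    then obtain w where "x = truncate m w" by blast
    then have "x = truncate m (restrict w {..<m})" by (simp add: truncate_def fun_eq_iff)
    moreover have "truncate m (restrict w {..<m}) \<in> truncate m ` ?P" by (rule imageI) (simp add: PiE_iff extensional_def)
    ultimately show "x \<in> truncate m ` ?P" by metis
  qed
  have fin: "finite ?P" by (intro finite_PiE) auto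
  have "card ?P = 4 ^ m" by (subst card_PiE) (auto simp: card_cartesian_product simp flip: UNIV_Times_UNIV)
  then show ?card
    using card_mono[OF finite_imageI[OF fin] sub] card_image_le[OF fin, of "truncate m"] by simp
  show ?fin using finite_subset[OF sub] fin by blast
qed

locale contraction =
  fixes \<rho> :: real
  assumes \<rho>_pos: "0 < \<rho>" and \<rho>_less: "\<rho> < 1"
begin

section \<open>Power series with bounded coefficients\<close>

lemma summable_coding:
  assumes "\<And>i. \<bar>d i\<bar> \<le> M"
  shows "summable (\<lambda>i. \<rho> ^ i * d i)"
proof (rule summable_comparison_test')
  show "summable (\<lambda>i. \<rho> ^ i * M)"
    using \<rho>_pos \<rho>_less by (intro summable_mult2 summable_geometric) auto
  show "norm (\<rho> ^ i * d i) \<le> \<rho> ^ i * M" for i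
    using assms \<rho>_pos by (auto simp: abs_mult)
qed

lemma abs_coding_map_le:
  assumes "\<And>i. \<bar>d i\<bar> \<le> M"
  shows "\<bar>coding_map \<rho> d\<bar> \<le> M / (1 - \<rho>)"
proof -
  have "(\<lambda>i. \<rho> ^ i * M) sums (1 / (1 - \<rho>) * M)"
    using \<rho>_pos \<rho>_less by (intro sums_mult2 geometric_sums) auto
  then have M: "summable (\<lambda>i. \<rho> ^ i * M)" "(\<Sum>i. \<rho> ^ i * M) = M / (1 - \<rho>)"
    by (auto simp: sums_iff)
  have le: "norm (\<rho> ^ i * d i) \<le> \<rho> ^ i * M" for i
    using assms \<rho>_pos by (auto simp: abs_mult)
  have "norm (\<Sum>i. \<rho> ^ i * d i) \<le> (\<Sum>i. \<rho> ^ i * M)"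
    by (rule norm_suminf_le[OF le M(1)])
  then show ?thesis by (simp add: coding_map_def M)
qed

lemma coding_map_diff:
  assumes "\<And>i. \<bar>d i\<bar> \<le> M" "\<And>i. \<bar>e i\<bar> \<le> M"
  shows "coding_map \<rho> d - coding_map \<rho> e = coding_map \<rho> (\<lambda>i. d i - e i)"
  using suminf_diff[OF summable_coding[of d M, OF assms(1)] summable_coding[of e M, OF assms(2)]]
  by (simp add: coding_map_def right_diff_distrib)

lemma coding_map_split:
  assumes "\<And>i. \<bar>d i\<bar> \<le> M"
  shows "coding_map \<rho> d = (\<Sum>i<n. \<rho> ^ i * d i) + \<rho> ^ n * coding_map \<rho> (\<lambda>i. d (i + n))"
proof -
  have "(\<Sum>i. \<rho> ^ (i + n) * d (i + n)) = (\<Sum>i. \<rho> ^ n * (\<rho> ^ i * d (i + n)))"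
    by (simp add: power_add mult_ac)
  also have "\<dots> = \<rho> ^ n * (\<Sum>i. \<rho> ^ i * d (i + n))"
    by (intro suminf_mult summable_coding[of _ M] assms)
  finally show ?thesis
    unfolding coding_map_def by (subst suminf_split_initial_segment[OF summable_coding[of d M, OF assms], of n]) simp
qed

section \<open>Coded points as functions of the parameter\<close>

lemma digit_bounds:
  assumes "lam \<in> {0<..<1 - \<rho>}"
  shows "0 \<le> digit \<rho> lam s" "digit \<rho> lam s \<le> 1 - \<rho>"
  using assms \<rho>_pos \<rho>_less by (auto simp: digit_def)

lemma abs_digit_le: "\<bar>digit \<rho> lam s\<bar> \<le> 1 + \<bar>lam\<bar>"
  using \<rho>_pos \<rho>_less by (auto simp: digit_def)

lemma abs_slope_le: "\<bar>slope s\<bar> \<le> 1"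
  by (auto simp: slope_def)

text \<open>Every digit is affine in \<open>lam\<close>, so the coded point is too, with slope and
  intercept given by series free of \<open>lam\<close>. Both transversality and joint measurability
  rest on this form.\<close>

lemma point_affine:
  "point \<rho> lam w = lam * coding_map \<rho> (\<lambda>i. slope (w i)) + (1 - \<rho>) * coding_map \<rho> (\<lambda>i. of_bool (snd (w i)))"
proof -
  have eq: "\<rho> ^ i * digit \<rho> lam (w i) = lam * (\<rho> ^ i * slope (w i)) + (1 - \<rho>) * (\<rho> ^ i * of_bool (snd (w i)))" for i
    by (auto simp: digit_def slope_def algebra_simps)
  have s: "summable (\<lambda>i. \<rho> ^ i * slope (w i))" "summable (\<lambda>i. \<rho> ^ i * of_bool (snd (w i)))"
    by (rule summable_coding[of _ 1]; simp add: abs_slope_le)+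
  show ?thesis
    unfolding point_def coding_map_def eq
    by (subst suminf_add[symmetric]) (intro summable_mult s | simp add: suminf_mult s)+
qed

lemma point_split:
  "point \<rho> lam w = (\<Sum>i<n. \<rho> ^ i * digit \<rho> lam (w i)) + \<rho> ^ n * point \<rho> lam (\<lambda>i. w (i + n))"
  unfolding point_def by (rule coding_map_split) (rule abs_digit_le)

lemma point_Suc: "point \<rho> lam w = digit \<rho> lam (w 0) + \<rho> * point \<rho> lam (\<lambda>i. w (Suc i))"
  using point_split[of lam w 1] by simp

text \<open>Self-similarity: cancelling a common prefix reduces comparisons to sequences that differ
  at the first symbol.\<close>

lemma point_diff_agree:
  assumes "\<And>i. i < n \<Longrightarrow> w i = v i"
  shows "point \<rho> lam w - point \<rho> lam v = \<rho> ^ n * (point \<rho> lam (\<lambda>i. w (i + n)) - point \<rho> lam (\<lambda>i. v (i + n)))"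
proof -
  have "(\<Sum>i<n. \<rho> ^ i * digit \<rho> lam (w i)) = (\<Sum>i<n. \<rho> ^ i * digit \<rho> lam (v i))"
    using assms by simp
  then show ?thesis
    using point_split[of lam w n] point_split[of lam v n] by (simp add: algebra_simps)
qed

text \<open>Two digits differ by at most \<open>1 - \<rho>\<close>, which cancels the factor
  \<open>1 / (1 - \<rho>)\<close> of the geometric series.\<close>

lemma abs_point_diff_le:
  assumes "lam \<in> {0<..<1 - \<rho>}"
  shows "\<bar>point \<rho> lam w - point \<rho> lam v\<bar> \<le> 1"
proof -
  have "\<bar>digit \<rho> lam (w i) - digit \<rho> lam (v i)\<bar> \<le> 1 - \<rho>" for i
    using digit_bounds[OF assms, of "w i"] digit_bounds[OF assms, of "v i"] by (auto simp: abs_le_iff)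
  then have "\<bar>coding_map \<rho> (\<lambda>i. digit \<rho> lam (w i) - digit \<rho> lam (v i))\<bar> \<le> (1 - \<rho>) / (1 - \<rho>)"
    by (rule abs_coding_map_le)
  then show ?thesis
    using \<rho>_less coding_map_diff[OF abs_digit_le abs_digit_le, of lam w v] by (simp add: point_def)
qed

lemma abs_point_diff_agree_le:
  assumes "lam \<in> {0<..<1 - \<rho>}" "\<And>i. i < n \<Longrightarrow> w i = v i"
  shows "\<bar>point \<rho> lam w - point \<rho> lam v\<bar> \<le> \<rho> ^ n"
  using abs_point_diff_le[OF assms(1)] \<rho>_pos
  by (subst point_diff_agree[OF assms(2)]) (auto simp: abs_mult intro!: mult_left_le)

lemma abs_point_truncate_le:
  assumes "lam \<in> {0<..<1 - \<rho>}"
  shows "\<bar>point \<rho> lam w - point \<rho> lam (truncate n w)\<bar> \<le> \<rho> ^ n"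
  by (rule abs_point_diff_agree_le[OF assms]) (simp add: truncate_def)

lemma bounded_range_point:
  assumes "lam \<in> {0<..<1 - \<rho>}"
  shows "bounded (range (point \<rho> lam))"
proof -
  have "range (point \<rho> lam) \<subseteq> cball (point \<rho> lam (\<lambda>_. (False, False))) 1"
    using abs_point_diff_le[OF assms] by (auto simp: dist_real_def)
  then show ?thesis using bounded_cball bounded_subset by blast
qed

section \<open>The attractor and its codings\<close>

text \<open>Following inverse branches from a point of \<open>K\<close> reads off a coding of it.
  Conversely, applying the branches of a word to any point of \<open>K\<close> stays in
  \<open>K\<close> and converges to the coded point, which lies in \<open>K\<close> because
  \<open>K\<close> is closed.\<close>

lemma attractor_eq_range_point:
  assumes "K \<noteq> {}" "compact K" and K: "K = (\<Union>d\<in>digits \<rho> lam. ifs_map \<rho> d ` K)"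
  shows "K = range (point \<rho> lam)"
proof
  have step: "\<exists>s y. y \<in> K \<and> x = \<rho> * y + digit \<rho> lam s" if "x \<in> K" for x
    using that by (subst (asm) K) (auto simp: range_digit[symmetric] ifs_map_def)
  then obtain S T where ST: "\<And>x. x \<in> K \<Longrightarrow> T x \<in> K \<and> x = \<rho> * T x + digit \<rho> lam (S x)"
    by metis
  have tends: "(\<lambda>n. \<Sum>i<n. \<rho> ^ i * digit \<rho> lam (w i)) \<longlonglongrightarrow> point \<rho> lam w" for w
    unfolding point_def coding_map_def
    by (intro summable_LIMSEQ summable_coding[of _ "1 + \<bar>lam\<bar>"] abs_digit_le)
  from \<open>compact K\<close> obtain b where b: "\<And>x. x \<in> K \<Longrightarrow> \<bar>x\<bar> \<le> b"
    using compact_imp_bounded bounded_iff by (metis real_norm_def)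
  have pow: "(\<lambda>n. \<rho> ^ n * y n) \<longlonglongrightarrow> 0" if "\<And>n. \<bar>y n\<bar> \<le> b" for y :: "nat \<Rightarrow> real"
    using summable_LIMSEQ_zero[OF summable_coding[OF that]] .
  show "K \<subseteq> range (point \<rho> lam)"
  proof
    fix x assume x: "x \<in> K"
    \<comment> \<open>The coding records the branch chosen at each step of the backward orbit under
      \<open>T\<close>.\<close>
    define w where "w i = S ((T ^^ i) x)" for i
    have TK: "(T ^^ n) x \<in> K" for n
      using ST x by (induction n) auto
    have eq: "x = (\<Sum>i<n. \<rho> ^ i * digit \<rho> lam (w i)) + \<rho> ^ n * (T ^^ n) x" for n
    proof (induction n)
      case (Suc n)
      have "(T ^^ n) x = \<rho> * (T ^^ Suc n) x + digit \<rho> lam (w n)"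
        using ST[OF TK[of n]] by (simp add: w_def)
      then have "\<rho> ^ n * (T ^^ n) x = \<rho> ^ n * (\<rho> * (T ^^ Suc n) x + digit \<rho> lam (w n))"
        by (rule arg_cong)
      then have "\<rho> ^ n * (T ^^ n) x = \<rho> ^ Suc n * (T ^^ Suc n) x + \<rho> ^ n * digit \<rho> lam (w n)"
        by (simp add: algebra_simps)
      with Suc show ?case by simp
    qed simp
    have "(\<lambda>n. (\<Sum>i<n. \<rho> ^ i * digit \<rho> lam (w i)) + \<rho> ^ n * (T ^^ n) x) \<longlonglongrightarrow> point \<rho> lam w + 0"
      by (intro tendsto_add tends pow b TK)
    then have "(\<lambda>n::nat. x) \<longlonglongrightarrow> point \<rho> lam w" using eq by simp
    then show "x \<in> range (point \<rho> lam)" using LIMSEQ_const_iff by auto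
  qed
  show "range (point \<rho> lam) \<subseteq> K"
  proof
    fix x assume "x \<in> range (point \<rho> lam)"
    then obtain w where x: "x = point \<rho> lam w" by blast
    obtain k where k: "k \<in> K" using \<open>K \<noteq> {}\<close> by blast
    \<comment> \<open>The induction step applies the branch of the first symbol to the remaining
      word, hence the generalisation over \<open>w\<close>.\<close>
    have mem: "(\<Sum>i<n. \<rho> ^ i * digit \<rho> lam (w i)) + \<rho> ^ n * k \<in> K" for n w
    proof (induction n arbitrary: w)
      case 0 then show ?case using k by simp
    next
      case (Suc n)
      have "ifs_map \<rho> (digit \<rho> lam (w 0)) ((\<Sum>i<n. \<rho> ^ i * digit \<rho> lam (w (Suc i))) + \<rho> ^ n * k) \<in> K"
        by (subst K, rule UN_I[where a = "digit \<rho> lam (w 0)"], simp add: range_digit[symmetric])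
          (rule imageI, rule Suc)
      then show ?case
        by (simp add: ifs_map_def sum.lessThan_Suc_shift sum_distrib_left algebra_simps del: sum.lessThan_Suc)
    qed
    have "(\<lambda>n. (\<Sum>i<n. \<rho> ^ i * digit \<rho> lam (w i)) + \<rho> ^ n * k) \<longlonglongrightarrow> point \<rho> lam w + 0"
      by (intro tendsto_add tends pow b k)
    then have "point \<rho> lam w + 0 \<in> K"
      by (rule closed_sequentially[OF compact_imp_closed[OF \<open>compact K\<close>] mem])
    then show "x \<in> K" using x by simp
  qed
qed

lemma self_similar_set_eq_range_point:
  assumes "lam \<in> {0<..<1 - \<rho>}"
  shows "self_similar_set \<rho> lam = range (point \<rho> lam)"
proof -
  define R where "R = range (point \<rho> lam)"
  \<comment> \<open>The closure of \<open>R\<close> is compact and invariant too, so \<open>attractor_eq_range_point\<close> gives \<open>R\<close> closed.\<close>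
  have R: "R = (\<Union>d\<in>digits \<rho> lam. ifs_map \<rho> d ` R)"
  proof
    show "R \<subseteq> (\<Union>d\<in>digits \<rho> lam. ifs_map \<rho> d ` R)"
    proof
      fix x assume "x \<in> R"
      then obtain w where "x = point \<rho> lam w" by (auto simp: R_def)
      then have "x = ifs_map \<rho> (digit \<rho> lam (w 0)) (point \<rho> lam (\<lambda>i. w (Suc i)))"
        using point_Suc[of lam w] by (simp add: ifs_map_def)
      then show "x \<in> (\<Union>d\<in>digits \<rho> lam. ifs_map \<rho> d ` R)"
        unfolding R_def range_digit[symmetric] by blast
    qed
    show "(\<Union>d\<in>digits \<rho> lam. ifs_map \<rho> d ` R) \<subseteq> R"
    proof clarsimp
      fix d x assume "d \<in> digits \<rho> lam" "x \<in> R"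
      then obtain s w where "d = digit \<rho> lam s" "x = point \<rho> lam w"
        by (auto simp: range_digit[symmetric] R_def)
      then have "ifs_map \<rho> d x = point \<rho> lam (case_nat s w)"
        using point_Suc[of lam "case_nat s w"] by (simp add: ifs_map_def)
      then show "ifs_map \<rho> d x \<in> R" by (simp add: R_def)
    qed
  qed
  have comp: "compact (closure R)"
    using bounded_range_point[OF assms] by (simp add: R_def)
  have cl: "closure (ifs_map \<rho> d ` R) = ifs_map \<rho> d ` closure R" for d
  proof
    have cont: "continuous_on X (ifs_map \<rho> d)" for X
      unfolding ifs_map_def by (intro continuous_intros)
    have "closed (ifs_map \<rho> d ` closure R)"
      by (intro compact_imp_closed compact_continuous_image cont comp)
    then show "closure (ifs_map \<rho> d ` R) \<subseteq> ifs_map \<rho> d ` closure R"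
      by (intro closure_minimal image_mono closure_subset)
    show "ifs_map \<rho> d ` closure R \<subseteq> closure (ifs_map \<rho> d ` R)"
      by (intro image_closure_subset cont closed_closure closure_subset)
  qed
  have "closure R = closure (\<Union>d\<in>digits \<rho> lam. ifs_map \<rho> d ` R)"
    using R by simp
  also have "\<dots> = (\<Union>d\<in>digits \<rho> lam. ifs_map \<rho> d ` closure R)"
    by (simp add: digits_def cl closure_Un)
  finally have inv: "closure R = (\<Union>d\<in>digits \<rho> lam. ifs_map \<rho> d ` closure R)" .
  have "R \<noteq> {}" by (simp add: R_def)
  show ?thesis
    unfolding self_similar_set_def R_def[symmetric]
  proof (rule the_equality)
    have "closure R = R"
      using attractor_eq_range_point[OF _ comp inv] \<open>R \<noteq> {}\<close> by (simp add: R_def)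
    then show "R \<noteq> {} \<and> compact R \<and> R = (\<Union>d\<in>digits \<rho> lam. ifs_map \<rho> d ` R)"
      using comp R \<open>R \<noteq> {}\<close> by simp
  qed (use attractor_eq_range_point in \<open>auto simp: R_def\<close>)
qed

text \<open>Uniqueness among symbol sequences implies uniqueness among digit sequences. The two may
  differ, since distinct symbols can name the same digit, as at
  \<open>lam = (1 - \<rho>) / 2\<close>.\<close>

lemma unique_codingI:
  assumes "lam \<in> {0<..<1 - \<rho>}" and unique: "\<And>v. point \<rho> lam v = point \<rho> lam w \<Longrightarrow> v = w"
  shows "point \<rho> lam w \<in> unique_coding_set \<rho> lam"
proof -
  have "codings \<rho> lam (point \<rho> lam w) = {\<lambda>i. digit \<rho> lam (w i)}"
  proof (intro equalityI subsetI)
    fix d assume "d \<in> codings \<rho> lam (point \<rho> lam w)"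
    then have d: "\<And>i. d i \<in> range (digit \<rho> lam)" "coding_map \<rho> d = point \<rho> lam w"
      by (auto simp: codings_def range_digit)
    then have "\<forall>i. \<exists>s. d i = digit \<rho> lam s" by blast
    then obtain v where v: "\<And>i. d i = digit \<rho> lam (v i)" by metis
    then have "d = (\<lambda>i. digit \<rho> lam (v i))" by auto
    then show "d \<in> {\<lambda>i. digit \<rho> lam (w i)}" using d(2) unique[of v] by (simp add: point_def)
  next
    fix d assume "d \<in> {\<lambda>i. digit \<rho> lam (w i)}"
    then show "d \<in> codings \<rho> lam (point \<rho> lam w)"
      by (auto simp: codings_def range_digit[symmetric] point_def)
  qed
  then show ?thesis
    using self_similar_set_eq_range_point[OF assms(1)] by (simp add: unique_coding_set_def)
qed

text \<open>The images of the \<open>4 ^ n\<close> cylinders of length \<open>n\<close> have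
  diameter at most \<open>\<rho> ^ n\<close> and form the required cover.\<close>

lemma hausdorff_dim_self_similar_subset_le:
  assumes "lam \<in> {0<..<1 - \<rho>}" and A: "A \<subseteq> self_similar_set \<rho> lam"
  shows "hausdorff_dim A \<le> ennreal (ln 4 / (- ln \<rho>))"
proof -
  have "\<exists>F. finite F \<and> card F \<le> 4 ^ n \<and> A \<subseteq> \<Union>F \<and> (\<forall>C\<in>F. bounded C \<and> diameter C \<le> \<rho> ^ n)" for n
  proof -
    define C where "C u = {point \<rho> lam w | w. truncate n w = u}" for u
    have "diameter (C u) \<le> \<rho> ^ n" for u
    proof (rule diameter_le)
      show "C u \<noteq> {} \<or> 0 \<le> \<rho> ^ n" using \<rho>_pos by simp
      fix x y assume "x \<in> C u" "y \<in> C u"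
      then obtain w v where wv: "x = point \<rho> lam w" "y = point \<rho> lam v" "truncate n w = truncate n v"
        by (auto simp: C_def)
      have "w i = v i" if "i < n" for i
        using fun_cong[OF wv(3), of i] that by (simp add: truncate_def)
      then show "norm (x - y) \<le> \<rho> ^ n"
        using abs_point_diff_agree_le[OF assms(1), of n w v] wv(1,2) by simp
    qed
    moreover have "bounded (C u)" for u
      by (rule bounded_subset[OF bounded_range_point[OF assms(1)]]) (auto simp: C_def)
    moreover have "A \<subseteq> \<Union>(C ` range (truncate n))"
    proof
      fix x assume "x \<in> A"
      then obtain w where "x = point \<rho> lam w"
        using A self_similar_set_eq_range_point[OF assms(1)] by auto
      then have "x \<in> C (truncate n w)" by (auto simp: C_def)
      then show "x \<in> \<Union>(C ` range (truncate n))" by blast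
    qed
    moreover have "card (C ` range (truncate n)) \<le> 4 ^ n"
      using card_image_le[OF finite_range_truncate, of C] card_range_truncate[of n] by (rule order.trans)
    moreover have "finite (C ` range (truncate n))"
      using finite_range_truncate by (rule finite_imageI)
    ultimately show ?thesis by blast
  qed
  then show ?thesis
    using hausdorff_dim_le_cover[OF \<rho>_pos \<rho>_less, of 4 A] by simp
qed

end

section \<open>The uniform Bernoulli measure\<close>

definition bernoulli_measure :: "(nat \<Rightarrow> bool \<times> bool) measure" where
  "bernoulli_measure = PiM UNIV (\<lambda>_. measure_pmf (pmf_of_set UNIV))"

lemma space_bernoulli_measure [simp]: "space bernoulli_measure = UNIV"
  by (simp add: bernoulli_measure_def space_PiM)

lemma prob_space_bernoulli_measure: "prob_space bernoulli_measure"
  unfolding bernoulli_measure_def by (intro prob_space_PiM prob_space_measure_pmf)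

lemma measurable_symbol [measurable (raw)]:
  assumes "f \<in> measurable N bernoulli_measure"
  shows "(\<lambda>x. f x i) \<in> measurable N (count_space UNIV)"
proof -
  have "(\<lambda>w. w i) \<in> measurable bernoulli_measure (measure_pmf (pmf_of_set UNIV))"
    unfolding bernoulli_measure_def by (rule measurable_component_singleton) simp
  then have "(\<lambda>w. w i) \<in> measurable bernoulli_measure (count_space UNIV)"
    by (simp cong: measurable_cong_sets)
  with assms show ?thesis by (rule measurable_compose)
qed

lemma emeasure_cylinder:
  "emeasure bernoulli_measure {v. \<forall>i<k. v i = w i} = ennreal ((1 / 4) ^ k)"
proof -
  interpret product_prob_space "\<lambda>_::nat. measure_pmf (pmf_of_set (UNIV :: (bool \<times> bool) set))" UNIV
    by unfold_locales
  have single: "emeasure (measure_pmf (pmf_of_set UNIV)) {s} = ennreal (1 / 4)" for s :: "bool \<times> bool"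
  proof -
    have "card (UNIV :: (bool \<times> bool) set) = 4"
      by (simp add: card_cartesian_product flip: UNIV_Times_UNIV)
    then show ?thesis by (simp add: emeasure_pmf_single)
  qed
  have "emeasure bernoulli_measure {v \<in> space bernoulli_measure. \<forall>i\<in>{..<k}. v i \<in> {w i}}
      = (\<Prod>i<k. emeasure (measure_pmf (pmf_of_set UNIV)) {w i})"
    unfolding bernoulli_measure_def by (rule emeasure_PiM_Collect) auto
  then show ?thesis
    unfolding single by (simp add: prod_ennreal Ball_def ennreal_power)
qed

section \<open>Transversality and the projected measure\<close>

locale small_contraction = contraction +
  assumes \<rho>_less_quarter: "\<rho> < 1 / 4"
begin

text \<open>
  The difference of two coded points is affine in \<open>lam\<close>. If the first symbols have distinct slopes, its
  slope is at least \<open>1 - 2 \<rho> / (1 - \<rho>) \<ge> 1/3\<close> in absolute value; otherwise the first digits are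
  \<open>0\<close> and \<open>1 - \<rho>\<close>, and the points are at distance at least \<open>1 - 2 \<rho> \<ge> 1/2\<close>.
\<close>
lemma transversality_first:
  assumes "w 0 \<noteq> v 0"
  shows "\<exists>c. {lam \<in> {0<..<1 - \<rho>}. \<bar>point \<rho> lam w - point \<rho> lam v\<bar> \<le> r} \<subseteq> {c - 3 * r..c + 3 * r}"
proof (cases "slope (w 0) = slope (v 0)")
  case True
  have half: "1 / 2 \<le> \<bar>point \<rho> lam w - point \<rho> lam v\<bar>" if lam: "lam \<in> {0<..<1 - \<rho>}" for lam
  proof -
    have "\<bar>digit \<rho> lam (w 0) - digit \<rho> lam (v 0)\<bar> = 1 - \<rho>"
      using True assms \<rho>_less by (cases "w 0"; cases "v 0") (auto simp: slope_def digit_def split: if_splits)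
    moreover have "\<bar>\<rho> * (point \<rho> lam (\<lambda>i. w (Suc i)) - point \<rho> lam (\<lambda>i. v (Suc i)))\<bar> \<le> \<rho>"
      using abs_point_diff_le[OF lam] \<rho>_pos by (auto simp: abs_mult intro!: mult_left_le)
    moreover have "point \<rho> lam w - point \<rho> lam v = (digit \<rho> lam (w 0) - digit \<rho> lam (v 0))
        + \<rho> * (point \<rho> lam (\<lambda>i. w (Suc i)) - point \<rho> lam (\<lambda>i. v (Suc i)))"
      using point_Suc[of lam w] point_Suc[of lam v] by (simp add: algebra_simps)
    ultimately show ?thesis using \<rho>_less_quarter by linarith
  qed
  \<comment> \<open>By \<open>half\<close> the set is empty unless \<open>r\<close> is at least
    \<open>1 / 2\<close>, and then \<open>3 * r\<close> exceeds every admissible parameter, so the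
    centre 0 works.\<close>
  have "{lam \<in> {0<..<1 - \<rho>}. \<bar>point \<rho> lam w - point \<rho> lam v\<bar> \<le> r} \<subseteq> {0 - 3 * r..0 + 3 * r}"
  proof
    fix lam assume "lam \<in> {lam \<in> {0<..<1 - \<rho>}. \<bar>point \<rho> lam w - point \<rho> lam v\<bar> \<le> r}"
    then have lam: "lam \<in> {0<..<1 - \<rho>}" and "\<bar>point \<rho> lam w - point \<rho> lam v\<bar> \<le> r" by auto
    with half[OF lam] have "1 / 2 \<le> r" by linarith
    with lam \<rho>_pos show "lam \<in> {0 - 3 * r..0 + 3 * r}" by auto
  qed
  then show ?thesis by blast
next
  case False
  define e where "e i = slope (w i) - slope (v i)" for i
  define a where "a = coding_map \<rho> e"
  define b where "b = (1 - \<rho>) * (coding_map \<rho> (\<lambda>i. of_bool (snd (w i))) - coding_map \<rho> (\<lambda>i. of_bool (snd (v i))))"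
  have e2: "\<bar>e i\<bar> \<le> 2" for i
    by (auto simp: e_def slope_def)
  have "1 \<le> \<bar>e 0\<bar>"
    using False by (auto simp: e_def slope_def split: if_splits)
  moreover have "a = e 0 + \<rho> * coding_map \<rho> (\<lambda>i. e (Suc i))"
    using coding_map_split[of e 2 1] e2 by (simp add: a_def)
  moreover have "\<bar>\<rho> * coding_map \<rho> (\<lambda>i. e (Suc i))\<bar> \<le> \<rho> * (2 / (1 - \<rho>))"
    unfolding abs_mult using \<rho>_pos by (intro mult_mono abs_coding_map_le e2) auto
  moreover have "\<rho> * (2 / (1 - \<rho>)) \<le> 2 / 3"
    using \<rho>_less_quarter by (simp add: field_simps)
  ultimately have a: "1 / 3 \<le> \<bar>a\<bar>" by linarith
  have diff: "point \<rho> lam w - point \<rho> lam v = lam * a + b" for lam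
  proof -
    have a_eq: "a = coding_map \<rho> (\<lambda>i. slope (w i)) - coding_map \<rho> (\<lambda>i. slope (v i))"
      unfolding a_def e_def[abs_def] by (rule coding_map_diff[symmetric]) (rule abs_slope_le)+
    show ?thesis unfolding point_affine b_def a_eq by (simp add: algebra_simps)
  qed
  \<comment> \<open>The centre is the zero of the affine difference; the factor 3 is the inverse of
    the lower bound for its slope.\<close>
  have "{lam \<in> {0<..<1 - \<rho>}. \<bar>point \<rho> lam w - point \<rho> lam v\<bar> \<le> r} \<subseteq> {- b / a - 3 * r..- b / a + 3 * r}"
  proof
    fix lam assume "lam \<in> {lam \<in> {0<..<1 - \<rho>}. \<bar>point \<rho> lam w - point \<rho> lam v\<bar> \<le> r}"
    then have "\<bar>lam * a + b\<bar> \<le> r" by (simp add: diff)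
    moreover have "lam * a + b = (lam - (- b / a)) * a" using a by (auto simp: field_simps)
    ultimately have "\<bar>lam - (- b / a)\<bar> * \<bar>a\<bar> \<le> r" by (simp add: abs_mult)
    then have "\<bar>lam - (- b / a)\<bar> * (1 / 3) \<le> r"
      using a by (elim order.trans[rotated]) (intro mult_left_mono, auto)
    then have "\<bar>lam - (- b / a)\<bar> \<le> 3 * r" by simp
    then show "lam \<in> {- b / a - 3 * r..- b / a + 3 * r}" unfolding abs_le_iff by simp
  qed
  then show ?thesis by blast
qed

text \<open>Parameter and sequence may vary together, as the applications of Fubini require.\<close>

lemma measurable_point [measurable (raw)]:
  assumes [measurable]: "f \<in> borel_measurable N" "g \<in> measurable N bernoulli_measure"
  shows "(\<lambda>x. point \<rho> (f x) (g x)) \<in> borel_measurable N"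
proof -
  have sym: "(\<lambda>x. h (g x i)) \<in> borel_measurable N" for h :: "bool \<times> bool \<Rightarrow> real" and i
    by (rule measurable_compose[OF measurable_symbol[OF assms(2)]]) simp
  note [measurable] = sym[of slope] sym[of "\<lambda>s. of_bool (snd s)"]
  show ?thesis
    unfolding point_affine coding_map_def by measurable
qed

lemma measurable_shift [measurable]:
  "(\<lambda>w i. w (i + n)) \<in> measurable bernoulli_measure bernoulli_measure"
proof -
  have "(\<lambda>w. \<lambda>i\<in>UNIV. w (i + n)) \<in> measurable bernoulli_measure bernoulli_measure"
    unfolding bernoulli_measure_def
    by (intro measurable_restrict measurable_component_singleton) simp
  then show ?thesis by (simp add: restrict_def)
qed

text \<open>The summand for the length \<open>k\<close> of the common prefix of \<open>v\<close> and \<open>w\<close> is the relevant one.\<close>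
lemma emeasure_close_le:
  "emeasure lborel {lam \<in> {0<..<1 - \<rho>}. \<bar>point \<rho> lam w - point \<rho> lam v\<bar> \<le> \<rho> ^ n}
    \<le> (\<Sum>k\<le>n. ennreal (6 * \<rho> ^ (n - k)) * indicator {v. \<forall>i<k. v i = w i} v)"
  (is "emeasure _ ?S \<le> ?sum")
proof -
  have summand_le: "ennreal (6 * \<rho> ^ (n - k)) \<le> ?sum" if "k \<le> n" "\<forall>i<k. v i = w i" for k
    using that member_le_sum[of k "{..n}" "\<lambda>k. ennreal (6 * \<rho> ^ (n - k)) * indicator {v. \<forall>i<k. v i = w i} v"]
    by simp
  show ?thesis
  proof (cases "\<forall>i<n. v i = w i")
    case True
    \<comment> \<open>On a common prefix of length at least \<open>n\<close> the summand
      \<open>k = n\<close> equals 6, which exceeds the length of the whole parameter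
      interval.\<close>
    have "emeasure lborel ?S \<le> emeasure lborel {0<..<1 - \<rho>}"
      by (intro emeasure_mono) auto
    also have "\<dots> = ennreal (1 - \<rho>)" using \<rho>_less by simp
    also have "\<dots> \<le> ennreal (6 * \<rho> ^ (n - n))" using \<rho>_pos by (intro ennreal_leI) simp
    also have "\<dots> \<le> ?sum" using True by (intro summand_le) auto
    finally show ?thesis .
  next
    case False
    define k where "k = (LEAST i. v i \<noteq> w i)"
    from False obtain j where j: "j < n" "v j \<noteq> w j" by blast
    have k: "v k \<noteq> w k" unfolding k_def by (rule LeastI) fact
    have "k \<le> j" unfolding k_def by (rule Least_le) fact
    with j have "k < n" by simp
    have agree: "v i = w i" if "i < k" for i
      using not_less_Least that unfolding k_def by blast
    obtain c where c: "{lam \<in> {0<..<1 - \<rho>}. \<bar>point \<rho> lam (\<lambda>i. w (i + k)) - point \<rho> lam (\<lambda>i. v (i + k))\<bar> \<le> \<rho> ^ (n - k)}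
        \<subseteq> {c - 3 * \<rho> ^ (n - k)..c + 3 * \<rho> ^ (n - k)}"
      using transversality_first[of "\<lambda>i. w (i + k)" "\<lambda>i. v (i + k)" "\<rho> ^ (n - k)"] k by auto
    \<comment> \<open>Removing the common prefix magnifies by \<open>\<rho> ^ - k\<close>: the tails
      must be \<open>\<rho> ^ (n - k)\<close>-close, and they differ at the first symbol.\<close>
    have "\<rho> ^ n = \<rho> ^ k * \<rho> ^ (n - k)" using \<open>k < n\<close> by (simp flip: power_add)
    then have "?S = {lam \<in> {0<..<1 - \<rho>}. \<bar>point \<rho> lam (\<lambda>i. w (i + k)) - point \<rho> lam (\<lambda>i. v (i + k))\<bar> \<le> \<rho> ^ (n - k)}"
      using \<rho>_pos point_diff_agree[of k w v] agree by (simp add: abs_mult)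
    with c have "emeasure lborel ?S \<le> emeasure lborel {c - 3 * \<rho> ^ (n - k)..c + 3 * \<rho> ^ (n - k)}"
      by (intro emeasure_mono) auto
    also have "\<dots> = ennreal (6 * \<rho> ^ (n - k))"
      using \<rho>_pos by (simp add: emeasure_lborel_Icc_eq)
    also have "\<dots> \<le> ?sum" using \<open>k < n\<close> agree by (intro summand_le) auto
    finally show ?thesis .
  qed
qed

section \<open>Mass of small balls, averaged over the parameter\<close>

definition ball_mass :: "nat \<Rightarrow> real \<Rightarrow> (nat \<Rightarrow> bool \<times> bool) \<Rightarrow> ennreal" where
  "ball_mass n lam w = emeasure bernoulli_measure {v. dist (point \<rho> lam w) (point \<rho> lam v) \<le> \<rho> ^ n}"

interpretation bern: prob_space bernoulli_measure
  by (rule prob_space_bernoulli_measure)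

interpretation pair_sigma_finite lborel bernoulli_measure ..

lemma measurable_ball_mass [measurable (raw)]:
  assumes [measurable]: "f \<in> borel_measurable N" "g \<in> measurable N bernoulli_measure"
  shows "(\<lambda>x. ball_mass n (f x) (g x)) \<in> borel_measurable N"
proof -
  have "(\<lambda>x. emeasure bernoulli_measure {v \<in> space bernoulli_measure.
      dist (point \<rho> (f x) (g x)) (point \<rho> (f x) v) \<le> \<rho> ^ n}) \<in> borel_measurable N"
    by measurable
  then show ?thesis by (simp add: ball_mass_def)
qed

text \<open>After exchanging the integrals, \<open>emeasure_close_le\<close> bounds the parameter
  integral for each \<open>v\<close>. Cylinders of length \<open>k\<close> have mass
  \<open>(1 / 4) ^ k\<close>, so the total is \<open>6 * (1 / 4) ^ n\<close> times a partial
  geometric sum with ratio \<open>4 * \<rho> < 1\<close>.\<close>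

lemma nn_integral_ball_mass_le:
  "(\<integral>\<^sup>+lam. indicator {0<..<1 - \<rho>} lam * ball_mass n lam w \<partial>lborel) \<le> ennreal (6 / (1 - 4 * \<rho>) * (1 / 4) ^ n)"
proof -
  define g :: "real \<Rightarrow> (nat \<Rightarrow> bool \<times> bool) \<Rightarrow> ennreal" where
    "g lam v = indicator {x. fst x \<in> {0<..<1 - \<rho>} \<and> \<bar>point \<rho> (fst x) w - point \<rho> (fst x) (snd x)\<bar> \<le> \<rho> ^ n} (lam, v)" for lam v
  have [measurable]: "(\<lambda>_. w) \<in> measurable N bernoulli_measure" for N :: "'b measure"
    by (rule measurable_const) simp
  have "Measurable.pred (lborel \<Otimes>\<^sub>M bernoulli_measure)
      (\<lambda>x. fst x \<in> {0<..<1 - \<rho>} \<and> \<bar>point \<rho> (fst x) w - point \<rho> (fst x) (snd x)\<bar> \<le> \<rho> ^ n)"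
    by measurable
  then have meas: "(\<lambda>(lam, v). g lam v) \<in> borel_measurable (lborel \<Otimes>\<^sub>M bernoulli_measure)"
    by (auto simp: g_def case_prod_beta pred_def space_pair_measure intro!: borel_measurable_indicator)
  have mass: "indicator {0<..<1 - \<rho>} lam * ball_mass n lam w = (\<integral>\<^sup>+v. g lam v \<partial>bernoulli_measure)" for lam
  proof -
    have "{v \<in> space bernoulli_measure. dist (point \<rho> lam w) (point \<rho> lam v) \<le> \<rho> ^ n} \<in> sets bernoulli_measure"
      by measurable
    then have "ball_mass n lam w = (\<integral>\<^sup>+v. indicator {v. dist (point \<rho> lam w) (point \<rho> lam v) \<le> \<rho> ^ n} v \<partial>bernoulli_measure)"
      by (simp add: ball_mass_def)
    moreover have "g lam v = indicator {0<..<1 - \<rho>} lam * indicator {v. dist (point \<rho> lam w) (point \<rho> lam v) \<le> \<rho> ^ n} v" for v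
      by (auto simp: g_def dist_real_def indicator_def)
    ultimately show ?thesis
      by (cases "lam \<in> {0<..<1 - \<rho>}") auto
  qed
  have "(\<integral>\<^sup>+lam. indicator {0<..<1 - \<rho>} lam * ball_mass n lam w \<partial>lborel)
      = (\<integral>\<^sup>+v. \<integral>\<^sup>+lam. g lam v \<partial>lborel \<partial>bernoulli_measure)"
    unfolding mass by (rule Fubini'[OF meas, symmetric])
  also have "\<dots> \<le> (\<integral>\<^sup>+v. (\<Sum>k\<le>n. ennreal (6 * \<rho> ^ (n - k)) * indicator {v. \<forall>i<k. v i = w i} v) \<partial>bernoulli_measure)"
  proof (rule nn_integral_mono)
    fix v
    define S where "S = {lam \<in> {0<..<1 - \<rho>}. \<bar>point \<rho> lam w - point \<rho> lam v\<bar> \<le> \<rho> ^ n}"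
    have "{lam \<in> space lborel. lam \<in> {0<..<1 - \<rho>} \<and> \<bar>point \<rho> lam w - point \<rho> lam v\<bar> \<le> \<rho> ^ n} \<in> sets lborel"
      unfolding point_affine by measurable
    then have "S \<in> sets lborel" by (simp add: S_def)
    moreover have "g lam v = indicator S lam" for lam
      by (auto simp: g_def S_def indicator_def)
    ultimately have "(\<integral>\<^sup>+lam. g lam v \<partial>lborel) = emeasure lborel S"
      by simp
    also have "\<dots> \<le> (\<Sum>k\<le>n. ennreal (6 * \<rho> ^ (n - k)) * indicator {v. \<forall>i<k. v i = w i} v)"
      unfolding S_def by (rule emeasure_close_le)
    finally show "(\<integral>\<^sup>+lam. g lam v \<partial>lborel) \<le> (\<Sum>k\<le>n. ennreal (6 * \<rho> ^ (n - k)) * indicator {v. \<forall>i<k. v i = w i} v)" .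
  qed
  also have "\<dots> = (\<Sum>k\<le>n. ennreal (6 * \<rho> ^ (n - k)) * ennreal ((1 / 4) ^ k))"
  proof -
    have cyl: "{v. \<forall>i<k. v i = w i} \<in> sets bernoulli_measure" for k
    proof -
      have "{v \<in> space bernoulli_measure. \<forall>i<k. v i = w i} \<in> sets bernoulli_measure" by measurable
      then show ?thesis by simp
    qed
    then show ?thesis
      by (subst nn_integral_sum) (auto simp: nn_integral_cmult_indicator emeasure_cylinder)
  qed
  also have "\<dots> = ennreal (\<Sum>k\<le>n. 6 * \<rho> ^ (n - k) * (1 / 4) ^ k)"
    using \<rho>_pos by (simp add: ennreal_mult[symmetric] sum_ennreal)
  also have "(\<Sum>k\<le>n. 6 * \<rho> ^ (n - k) * (1 / 4) ^ k) = 6 * (1 / 4) ^ n * (\<Sum>k\<le>n. (4 * \<rho>) ^ (n - k))"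
    unfolding sum_distrib_left
  proof (rule sum.cong[OF refl])
    fix k assume "k \<in> {..n}"
    then have "(4::real) ^ n = 4 ^ k * 4 ^ (n - k)" by (simp flip: power_add)
    then show "6 * \<rho> ^ (n - k) * (1 / 4) ^ k = 6 * (1 / 4) ^ n * (4 * \<rho>) ^ (n - k)"
      by (simp add: field_simps)
  qed
  also have "(\<Sum>k\<le>n. (4 * \<rho>) ^ (n - k)) = (\<Sum>k\<le>n. (4 * \<rho>) ^ k)"
    by (rule sum.nat_diff_reindex[of _ "Suc n", unfolded lessThan_Suc_atMost, simplified])
  also have "ennreal (6 * (1 / 4) ^ n * (\<Sum>k\<le>n. (4 * \<rho>) ^ k)) \<le> ennreal (6 * (1 / 4) ^ n * (1 / (1 - 4 * \<rho>)))"
  proof (intro ennreal_leI mult_left_mono)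
    have s: "(\<lambda>k. (4 * \<rho>) ^ k) sums (1 / (1 - 4 * \<rho>))"
      using \<rho>_pos \<rho>_less_quarter by (intro geometric_sums) auto
    show "(\<Sum>k\<le>n. (4 * \<rho>) ^ k) \<le> 1 / (1 - 4 * \<rho>)"
      using sum_le_suminf[OF sums_summable[OF s], of "{..n}"] sums_unique[OF s] \<rho>_pos by simp
  qed simp
  finally show ?thesis by (simp add: mult_ac)
qed

text \<open>The weights \<open>(4 * \<theta>) ^ n\<close> turn the integral bounds into a multiple
  of the convergent series of \<open>\<theta> ^ n\<close>; a nonnegative function with finite
  integral is finite almost everywhere.\<close>

lemma AE_parameter_mass_decay:
  assumes \<theta>: "0 < \<theta>" "\<theta> < 1"
  shows "AE lam in lborel. lam \<in> {0<..<1 - \<rho>} \<longrightarrow> (\<Sum>n. ennreal ((4 * \<theta>) ^ n) * ball_mass n lam w) \<noteq> \<infinity>"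
proof -
  define h where "h n lam = ennreal ((4 * \<theta>) ^ n) * (indicator {0<..<1 - \<rho>} lam * ball_mass n lam w)" for n lam
  have [measurable]: "(\<lambda>_. w) \<in> measurable lborel bernoulli_measure"
    by (rule measurable_const) simp
  have [measurable]: "h n \<in> borel_measurable lborel" for n
    unfolding h_def[abs_def] by measurable
  have "(\<integral>\<^sup>+lam. (\<Sum>n. h n lam) \<partial>lborel) = (\<Sum>n. \<integral>\<^sup>+lam. h n lam \<partial>lborel)"
    by (rule nn_integral_suminf) measurable
  also have "\<dots> \<le> (\<Sum>n. ennreal (6 / (1 - 4 * \<rho>) * \<theta> ^ n))"
  proof (intro suminf_le)
    fix n
    have cancel: "(4 * \<theta>) ^ n * (C * (1 / 4) ^ n) = C * \<theta> ^ n" for C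
      by (simp add: power_mult_distrib power_one_over)
    have "(\<integral>\<^sup>+lam. h n lam \<partial>lborel) = ennreal ((4 * \<theta>) ^ n) * (\<integral>\<^sup>+lam. indicator {0<..<1 - \<rho>} lam * ball_mass n lam w \<partial>lborel)"
      unfolding h_def by (rule nn_integral_cmult) measurable
    also have "\<dots> \<le> ennreal ((4 * \<theta>) ^ n) * ennreal (6 / (1 - 4 * \<rho>) * (1 / 4) ^ n)"
      by (intro mult_left_mono nn_integral_ball_mass_le) simp
    also have "\<dots> = ennreal ((4 * \<theta>) ^ n * (6 / (1 - 4 * \<rho>) * (1 / 4) ^ n))"
      using \<rho>_less_quarter \<theta> by (intro ennreal_mult[symmetric]) auto
    also have "(4 * \<theta>) ^ n * (6 / (1 - 4 * \<rho>) * (1 / 4) ^ n) = 6 / (1 - 4 * \<rho>) * \<theta> ^ n"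
      by (simp only: cancel)
    finally show "(\<integral>\<^sup>+lam. h n lam \<partial>lborel) \<le> ennreal (6 / (1 - 4 * \<rho>) * \<theta> ^ n)" .
  qed auto
  also have "\<dots> < \<infinity>"
  proof -
    have "summable (\<lambda>n. 6 / (1 - 4 * \<rho>) * \<theta> ^ n)"
      using \<theta> by (intro summable_mult summable_geometric) auto
    then have "(\<Sum>n. ennreal (6 / (1 - 4 * \<rho>) * \<theta> ^ n)) = ennreal (\<Sum>n. 6 / (1 - 4 * \<rho>) * \<theta> ^ n)"
      using \<theta> \<rho>_less_quarter by (intro suminf_ennreal2) auto
    then show ?thesis by simp
  qed
  finally have "AE lam in lborel. (\<Sum>n. h n lam) \<noteq> \<infinity>"
    by (intro nn_integral_PInf_AE) auto
  then show ?thesis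
    by eventually_elim (auto simp: h_def)
qed

section \<open>Uniqueness of codings for almost every parameter\<close>

text \<open>A finitary condition that forces \<open>w\<close> to be a unique coding and is visibly measurable in \<open>(lam, w)\<close>.\<close>
definition separated :: "real \<Rightarrow> (nat \<Rightarrow> bool \<times> bool) \<Rightarrow> bool" where
  "separated lam w \<longleftrightarrow> (\<forall>n. \<exists>m. \<forall>v\<in>range (truncate (Suc m)).
    v 0 \<noteq> w n \<longrightarrow> \<rho> ^ Suc m < \<bar>point \<rho> lam (\<lambda>i. w (i + n)) - point \<rho> lam v\<bar>)"

lemma point_eq_first_difference:
  assumes "point \<rho> lam v = point \<rho> lam w" "v \<noteq> w"
  obtains n where "v n \<noteq> w n" "point \<rho> lam (\<lambda>i. v (i + n)) = point \<rho> lam (\<lambda>i. w (i + n))"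
proof -
  define n where "n = (LEAST i. v i \<noteq> w i)"
  from assms obtain j where "v j \<noteq> w j" by blast
  then have n: "v n \<noteq> w n" unfolding n_def by (rule LeastI)
  have "v i = w i" if "i < n" for i
    using not_less_Least that unfolding n_def by blast
  from point_diff_agree[of n v w lam, OF this] assms \<rho>_pos
  have "point \<rho> lam (\<lambda>i. v (i + n)) = point \<rho> lam (\<lambda>i. w (i + n))" by simp
  with n show ?thesis by (rule that)
qed

text \<open>After removing the common prefix, truncating the competing tail to length
  \<open>Suc m\<close> keeps its first symbol and moves its point by at most
  \<open>\<rho> ^ Suc m\<close>, contradicting the strict inequality in
  \<open>separated\<close>.\<close>

lemma separated_imp_unique:
  assumes lam: "lam \<in> {0<..<1 - \<rho>}" and sep: "separated lam w"
    and eq: "point \<rho> lam v = point \<rho> lam w"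
  shows "v = w"
proof (rule ccontr)
  assume "v \<noteq> w"
  with eq obtain n where n: "v n \<noteq> w n" "point \<rho> lam (\<lambda>i. v (i + n)) = point \<rho> lam (\<lambda>i. w (i + n))"
    by (rule point_eq_first_difference)
  obtain m where m: "\<And>u. u 0 \<noteq> w n \<Longrightarrow> u \<in> range (truncate (Suc m)) \<Longrightarrow>
      \<rho> ^ Suc m < \<bar>point \<rho> lam (\<lambda>i. w (i + n)) - point \<rho> lam u\<bar>"
    using sep unfolding separated_def by blast
  have "\<rho> ^ Suc m < \<bar>point \<rho> lam (\<lambda>i. w (i + n)) - point \<rho> lam (truncate (Suc m) (\<lambda>i. v (i + n)))\<bar>"
    by (rule m) (auto simp: truncate_def n(1))
  then show False
    using abs_point_truncate_le[OF lam, of "\<lambda>i. v (i + n)" "Suc m"] n(2) by simp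
qed

lemma tendsto_card_mult_power:
  assumes "\<And>m. card (F m) \<le> N ^ Suc m" "real N * \<rho> < 1"
  shows "(\<lambda>m. real (card (F m)) * (C * \<rho> ^ Suc m)) \<longlonglongrightarrow> 0"
proof -
  have "(\<lambda>m. (real N * \<rho>) ^ m) \<longlonglongrightarrow> 0"
    using assms(2) \<rho>_pos by (intro LIMSEQ_power_zero) auto
  then have lim: "(\<lambda>m. (real N * \<rho>) ^ Suc m) \<longlonglongrightarrow> 0" by (rule LIMSEQ_Suc)
  have "(\<lambda>m. real (card (F m)) * \<rho> ^ Suc m) \<longlonglongrightarrow> 0"
  proof (rule tendsto_sandwich[OF _ _ tendsto_const lim])
    have "real (card (F m)) * \<rho> ^ Suc m \<le> (real N * \<rho>) ^ Suc m" for m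
      unfolding power_mult_distrib
      using assms(1)[of m] \<rho>_pos by (intro mult_right_mono) (simp_all flip: of_nat_power of_nat_mult add: power_Suc)
    then show "\<forall>\<^sub>F m in sequentially. real (card (F m)) * \<rho> ^ Suc m \<le> (real N * \<rho>) ^ Suc m" by simp
  qed (use \<rho>_pos in simp)
  then have "(\<lambda>m. C * (real (card (F m)) * \<rho> ^ Suc m)) \<longlonglongrightarrow> C * 0"
    by (intro tendsto_mult tendsto_const)
  then show ?thesis by (simp add: mult_ac)
qed

text \<open>For each shift \<open>n\<close>, at most \<open>4 ^ Suc m\<close> words compete and each
  excludes an interval of half-length \<open>3 * \<rho> ^ Suc m\<close>. The total length tends to 0
  because \<open>4 * \<rho> < 1\<close>, and there are countably many shifts.\<close>

lemma AE_parameter_separated: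
  "AE lam in lborel. lam \<in> {0<..<1 - \<rho>} \<longrightarrow> separated lam w"
proof -
  have "AE lam in lborel. lam \<in> {0<..<1 - \<rho>} \<longrightarrow> (\<exists>m. \<forall>v\<in>range (truncate (Suc m)).
      v 0 \<noteq> w n \<longrightarrow> \<rho> ^ Suc m < \<bar>point \<rho> lam (\<lambda>i. w (i + n)) - point \<rho> lam v\<bar>)" for n
  proof -
    define S where "S m v = {lam \<in> {0<..<1 - \<rho>}. v 0 \<noteq> w n \<and>
      \<bar>point \<rho> lam (\<lambda>i. w (i + n)) - point \<rho> lam v\<bar> \<le> \<rho> ^ Suc m}" for m v
    have card: "card (range (truncate (Suc m))) \<le> 4 ^ Suc m" for m
      by (rule card_range_truncate)
    have "AE lam in lborel. \<exists>m. \<forall>v\<in>range (truncate (Suc m)). lam \<notin> S m v"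
    proof (rule AE_escape_finite_covers)
      show "(\<lambda>m. real (card (range (truncate (Suc m)))) * (3 * \<rho> ^ Suc m)) \<longlonglongrightarrow> 0"
        using \<rho>_less_quarter by (intro tendsto_card_mult_power[OF card]) simp
      show "\<exists>c. S m v \<subseteq> {c - 3 * \<rho> ^ Suc m..c + 3 * \<rho> ^ Suc m}" for m v
      proof (cases "v 0 = w n")
        case True
        then show ?thesis by (simp add: S_def)
      next
        case False
        then show ?thesis
          using transversality_first[of "\<lambda>i. w (i + n)" v "\<rho> ^ Suc m"] by (simp add: S_def)
      qed
    qed (use \<rho>_pos finite_range_truncate in auto)
    then show ?thesis
    proof eventually_elim
      case (elim lam)
      then obtain m where "\<forall>v\<in>range (truncate (Suc m)). lam \<notin> S m v" by blast
      then show ?case unfolding S_def by (intro impI exI[of _ m]) fastforce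
    qed
  qed
  then have "AE lam in lborel. \<forall>n. lam \<in> {0<..<1 - \<rho>} \<longrightarrow> (\<exists>m. \<forall>v\<in>range (truncate (Suc m)).
      v 0 \<noteq> w n \<longrightarrow> \<rho> ^ Suc m < \<bar>point \<rho> lam (\<lambda>i. w (i + n)) - point \<rho> lam v\<bar>)"
    unfolding AE_all_countable by blast
  then show ?thesis
    by eventually_elim (simp add: separated_def)
qed

text \<open>The same count with both sequences free: there are at most \<open>16 ^ Suc m\<close>
  pairs of words, and truncating both tails doubles the tolerance, which turns 3 into 6.\<close>

lemma AE_parameter_inj:
  assumes "\<rho> < 1 / 16"
  shows "AE lam in lborel. lam \<in> {0<..<1 - \<rho>} \<longrightarrow> inj (point \<rho> lam)"
proof -
  define F where "F m = range (truncate (Suc m)) \<times> range (truncate (Suc m))" for m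
  define S where "S m p = {lam \<in> {0<..<1 - \<rho>}. fst p 0 \<noteq> snd p 0 \<and>
    \<bar>point \<rho> lam (fst p) - point \<rho> lam (snd p)\<bar> \<le> 2 * \<rho> ^ Suc m}" for m p
  have "AE lam in lborel. \<exists>m. \<forall>p\<in>F m. lam \<notin> S m p"
  proof (rule AE_escape_finite_covers)
    have "card (F m) \<le> 16 ^ Suc m" for m
    proof -
      have "card (F m) \<le> 4 ^ Suc m * 4 ^ Suc m"
        unfolding F_def card_cartesian_product by (intro mult_mono card_range_truncate) auto
      also have "\<dots> = 16 ^ Suc m" by (simp flip: power_mult_distrib)
      finally show ?thesis .
    qed
    then show "(\<lambda>m. real (card (F m)) * (6 * \<rho> ^ Suc m)) \<longlonglongrightarrow> 0"
      using assms by (intro tendsto_card_mult_power[of _ 16]) auto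
    show "\<exists>c. S m p \<subseteq> {c - 6 * \<rho> ^ Suc m..c + 6 * \<rho> ^ Suc m}" for m p
    proof (cases "fst p 0 = snd p 0")
      case True
      then show ?thesis by (simp add: S_def)
    next
      case False
      then show ?thesis
        using transversality_first[of "fst p" "snd p" "2 * \<rho> ^ Suc m"] by (simp add: S_def)
    qed
  qed (use \<rho>_pos finite_range_truncate in \<open>auto simp: F_def\<close>)
  then show ?thesis
  proof eventually_elim
    case (elim lam)
    then obtain m where m: "\<And>p. p \<in> F m \<Longrightarrow> lam \<notin> S m p" by blast
    show ?case
    proof (intro impI injI, rule ccontr)
      fix v w assume lam: "lam \<in> {0<..<1 - \<rho>}" and eq: "point \<rho> lam v = point \<rho> lam w" "v \<noteq> w"
      from eq obtain n where n: "v n \<noteq> w n" "point \<rho> lam (\<lambda>i. v (i + n)) = point \<rho> lam (\<lambda>i. w (i + n))"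
        by (rule point_eq_first_difference)
      let ?v = "truncate (Suc m) (\<lambda>i. v (i + n))" and ?w = "truncate (Suc m) (\<lambda>i. w (i + n))"
      have "\<bar>point \<rho> lam ?v - point \<rho> lam ?w\<bar> \<le> 2 * \<rho> ^ Suc m"
        using abs_point_truncate_le[OF lam, of "\<lambda>i. v (i + n)" "Suc m"]
          abs_point_truncate_le[OF lam, of "\<lambda>i. w (i + n)" "Suc m"] n(2) by linarith
      moreover have "?v 0 \<noteq> ?w 0" using n(1) by (simp add: truncate_def)
      ultimately have "lam \<in> S m (?v, ?w)" using lam by (simp add: S_def)
      moreover have "(?v, ?w) \<in> F m" by (simp add: F_def)
      ultimately show False using m by blast
    qed
  qed
qed

section \<open>Dimension bound for almost every parameter\<close>

text \<open>Fubini for null sets: a jointly measurable property that holds for almost every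
  parameter at each fixed sequence holds, for almost every parameter, at almost every
  sequence.\<close>

lemma AE_swap:
  assumes "Measurable.pred (lborel \<Otimes>\<^sub>M bernoulli_measure) (\<lambda>x. Q (fst x) (snd x))"
    and "\<And>w. AE lam in lborel. Q lam w"
  shows "AE lam in lborel. AE w in bernoulli_measure. Q lam w"
proof -
  have "{x \<in> space (lborel \<Otimes>\<^sub>M bernoulli_measure). Q (fst x) (snd x)} \<in> sets (lborel \<Otimes>\<^sub>M bernoulli_measure)"
    using assms(1) by (rule predE)
  from AE_commute[OF this] show ?thesis using assms(2) by simp
qed

lemma AE_AE_separated:
  "AE lam in lborel. AE w in bernoulli_measure. lam \<in> {0<..<1 - \<rho>} \<longrightarrow> separated lam w"
proof (rule AE_swap[OF _ AE_parameter_separated])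
  have [measurable]: "(\<lambda>_. v) \<in> measurable N bernoulli_measure" for N :: "'b measure" and v
    by (rule measurable_const) simp
  have [measurable]: "Measurable.pred (lborel \<Otimes>\<^sub>M bernoulli_measure) (\<lambda>x. v 0 \<noteq> snd x n)" for v :: "nat \<Rightarrow> bool \<times> bool" and n
    by measurable
  \<comment> \<open>Only finitely many words occur at each level; the remaining quantifiers over
    \<open>n\<close> and \<open>m\<close> are countable.\<close>
  have "Measurable.pred (lborel \<Otimes>\<^sub>M bernoulli_measure) (\<lambda>x. \<forall>v\<in>range (truncate (Suc m)).
    v 0 \<noteq> snd x n \<longrightarrow> \<rho> ^ Suc m < \<bar>point \<rho> (fst x) (\<lambda>i. snd x (i + n)) - point \<rho> (fst x) v\<bar>)" for m n
    by (intro pred_intros_finite finite_range_truncate) measurable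
  then show "Measurable.pred (lborel \<Otimes>\<^sub>M bernoulli_measure) (\<lambda>x. fst x \<in> {0<..<1 - \<rho>} \<longrightarrow> separated (fst x) (snd x))"
    unfolding separated_def by measurable
qed

lemma AE_AE_mass_decay:
  assumes "0 < \<theta>" "\<theta> < 1"
  shows "AE lam in lborel. AE w in bernoulli_measure. lam \<in> {0<..<1 - \<rho>} \<longrightarrow>
    (\<Sum>n. ennreal ((4 * \<theta>) ^ n) * ball_mass n lam w) \<noteq> \<infinity>"
  by (rule AE_swap[OF _ AE_parameter_mass_decay[OF assms]]) measurable

text \<open>A finite sum bounds each of its nonnegative terms, which gives the ball estimate with a
  constant depending on \<open>w\<close>. The exponent is chosen so that \<rho> raised to it equals
  \<open>1 / (4 * \<theta>)\<close>, and \<open>1 / 4 < \<theta>\<close> makes it positive.\<close>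

lemma hausdorff_dim_unique_coding_set_ge_of_decay:
  assumes lam: "lam \<in> {0<..<1 - \<rho>}" and \<theta>: "1 / 4 < \<theta>"
    and sep: "AE w in bernoulli_measure. separated lam w"
    and decay: "AE w in bernoulli_measure. (\<Sum>n. ennreal ((4 * \<theta>) ^ n) * ball_mass n lam w) \<noteq> \<infinity>"
  shows "ennreal (ln (4 * \<theta>) / (- ln \<rho>)) \<le> hausdorff_dim (unique_coding_set \<rho> lam)"
proof (rule hausdorff_dim_ge_mass_distribution[OF prob_space_bernoulli_measure _ \<rho>_pos \<rho>_less])
  show "point \<rho> lam \<in> borel_measurable bernoulli_measure" by measurable
  have ln\<rho>: "ln \<rho> < 0" using \<rho>_pos \<rho>_less by simp
  then show "0 < ln (4 * \<theta>) / (- ln \<rho>)"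
    using \<theta> by (intro divide_pos_pos) auto
  have q: "\<rho> powr (ln (4 * \<theta>) / (- ln \<rho>)) = 1 / (4 * \<theta>)"
    using ln\<rho> \<theta> \<rho>_pos by (simp add: powr_def exp_minus inverse_eq_divide)
  show "AE w in bernoulli_measure. point \<rho> lam w \<in> unique_coding_set \<rho> lam \<and>
    (\<exists>K. \<forall>n. emeasure bernoulli_measure {v \<in> space bernoulli_measure. dist (point \<rho> lam w) (point \<rho> lam v) \<le> \<rho> ^ n}
      \<le> ennreal (K * (\<rho> powr (ln (4 * \<theta>) / (- ln \<rho>))) ^ n))"
    using sep decay
  proof eventually_elim
    case (elim w)
    define K where "K = enn2real (\<Sum>n. ennreal ((4 * \<theta>) ^ n) * ball_mass n lam w)"
    have K: "ennreal K = (\<Sum>n. ennreal ((4 * \<theta>) ^ n) * ball_mass n lam w)"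
      using elim(2) by (simp add: K_def less_top)
    have "K \<ge> 0" by (simp add: K_def)
    have "ball_mass n lam w \<le> ennreal (K * (1 / (4 * \<theta>)) ^ n)" for n
    proof -
      have "ennreal ((4 * \<theta>) ^ n) * ball_mass n lam w \<le> ennreal K"
        unfolding K using sum_le_suminf[of "\<lambda>n. ennreal ((4 * \<theta>) ^ n) * ball_mass n lam w" "{n}"] by simp
      then have "ennreal ((1 / (4 * \<theta>)) ^ n) * (ennreal ((4 * \<theta>) ^ n) * ball_mass n lam w)
          \<le> ennreal ((1 / (4 * \<theta>)) ^ n) * ennreal K"
        by (rule mult_left_mono) simp
      moreover have "ennreal ((1 / (4 * \<theta>)) ^ n) * ennreal ((4 * \<theta>) ^ n) = 1"
        using \<theta> by (subst ennreal_mult[symmetric]) (auto simp: power_one_over)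
      moreover have "ennreal ((1 / (4 * \<theta>)) ^ n) * ennreal K = ennreal (K * (1 / (4 * \<theta>)) ^ n)"
        using \<theta> \<open>K \<ge> 0\<close> by (subst ennreal_mult[symmetric]) (auto simp: mult.commute)
      ultimately show ?thesis
        by (metis mult.assoc mult_1)
    qed
    then have "\<forall>n. emeasure bernoulli_measure {v \<in> space bernoulli_measure. dist (point \<rho> lam w) (point \<rho> lam v) \<le> \<rho> ^ n}
      \<le> ennreal (K * (\<rho> powr (ln (4 * \<theta>) / (- ln \<rho>))) ^ n)"
      unfolding q by (simp add: ball_mass_def)
    moreover have "point \<rho> lam w \<in> unique_coding_set \<rho> lam"
      using separated_imp_unique[OF lam elim(1)] by (intro unique_codingI[OF lam])
    ultimately show ?case by blast
  qed
qed

text \<open>Letting \<theta> tend to 1 along a sequence leaves countably many exceptional sets,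
  whose union is still null.\<close>

lemma AE_hausdorff_dim_unique_coding_set_ge:
  "AE lam in lborel. lam \<in> {0<..<1 - \<rho>} \<longrightarrow>
    ennreal (ln 4 / (- ln \<rho>)) \<le> hausdorff_dim (unique_coding_set \<rho> lam)"
proof -
  \<comment> \<open>The double successor makes the sequence start at \<open>1 / 2\<close>, above the
    required \<open>1 / 4\<close>.\<close>
  define \<theta> :: "nat \<Rightarrow> real" where "\<theta> k = 1 - 1 / real (Suc (Suc k))" for k
  have \<theta>: "1 / 4 < \<theta> k" "\<theta> k < 1" for k
    by (auto simp: \<theta>_def field_simps)
  have "\<theta> \<longlonglongrightarrow> 1 - 0"
    unfolding \<theta>_def[abs_def]
    by (intro tendsto_diff tendsto_const LIMSEQ_Suc[OF LIMSEQ_Suc[OF lim_1_over_n]])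
  then have "(\<lambda>k. ennreal (ln (4 * \<theta> k) / (- ln \<rho>))) \<longlonglongrightarrow> ennreal (ln (4 * 1) / (- ln \<rho>))"
    using \<rho>_pos \<rho>_less by (intro tendsto_ennrealI tendsto_divide tendsto_ln tendsto_mult tendsto_const) auto
  then have lim: "(\<lambda>k. ennreal (ln (4 * \<theta> k) / (- ln \<rho>))) \<longlonglongrightarrow> ennreal (ln 4 / (- ln \<rho>))"
    by simp
  have "AE lam in lborel. AE w in bernoulli_measure. lam \<in> {0<..<1 - \<rho>} \<longrightarrow>
    (\<Sum>n. ennreal ((4 * \<theta> k) ^ n) * ball_mass n lam w) \<noteq> \<infinity>" for k
    using \<theta>[of k] by (intro AE_AE_mass_decay) auto
  then have "AE lam in lborel. \<forall>k. AE w in bernoulli_measure. lam \<in> {0<..<1 - \<rho>} \<longrightarrow>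
    (\<Sum>n. ennreal ((4 * \<theta> k) ^ n) * ball_mass n lam w) \<noteq> \<infinity>"
    unfolding AE_all_countable by blast
  with AE_AE_separated show ?thesis
  proof eventually_elim
    case (elim lam)
    show ?case
    proof
      assume lam: "lam \<in> {0<..<1 - \<rho>}"
      have "ennreal (ln (4 * \<theta> k) / (- ln \<rho>)) \<le> hausdorff_dim (unique_coding_set \<rho> lam)" for k
        using elim lam \<theta>[of k] by (intro hausdorff_dim_unique_coding_set_ge_of_decay) auto
      then show "ennreal (ln 4 / (- ln \<rho>)) \<le> hausdorff_dim (unique_coding_set \<rho> lam)"
        by (intro LIMSEQ_le_const2[OF lim]) auto
    qed
  qed
qed

end

theorem theorem1p8:
  fixes \<rho> :: real
  assumes "0 < \<rho>" and "\<rho> < 1/4"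
  shows "(AE lam\<in>{0<..<\<rho>} \<union> {(1 - 2 * \<rho>) / 2<..<(1 - \<rho>) / 2} in lebesgue.
            hausdorff_dim (unique_coding_set \<rho> lam) = hausdorff_dim (self_similar_set \<rho> lam) \<and>
            hausdorff_dim (self_similar_set \<rho> lam) = ennreal (ln 4 / (- ln \<rho>))) \<and>
         (\<rho> < 1/16 \<longrightarrow>
            (AE lam\<in>{0<..<\<rho>} \<union> {(1 - 2 * \<rho>) / 2<..<(1 - \<rho>) / 2} in lebesgue.
               unique_coding_set \<rho> lam = self_similar_set \<rho> lam))"
proof -
  interpret small_contraction \<rho>
    by unfold_locales (use assms in auto)
  have sub: "lam \<in> {0<..<1 - \<rho>}" if "lam \<in> {0<..<\<rho>} \<union> {(1 - 2 * \<rho>) / 2<..<(1 - \<rho>) / 2}" for lam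
    using that assms by auto
  have U: "unique_coding_set \<rho> lam \<subseteq> self_similar_set \<rho> lam" for lam
    by (auto simp: unique_coding_set_def)
  show ?thesis
  proof (intro conjI impI)
    have "AE lam in lebesgue. lam \<in> {0<..<1 - \<rho>} \<longrightarrow>
        ennreal (ln 4 / (- ln \<rho>)) \<le> hausdorff_dim (unique_coding_set \<rho> lam)"
      by (rule AE_completion[OF AE_hausdorff_dim_unique_coding_set_ge])
    then show "AE lam\<in>{0<..<\<rho>} \<union> {(1 - 2 * \<rho>) / 2<..<(1 - \<rho>) / 2} in lebesgue.
        hausdorff_dim (unique_coding_set \<rho> lam) = hausdorff_dim (self_similar_set \<rho> lam) \<and>
        hausdorff_dim (self_similar_set \<rho> lam) = ennreal (ln 4 / (- ln \<rho>))"
    proof eventually_elim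
      case (elim lam)
      show ?case
      proof
        assume "lam \<in> {0<..<\<rho>} \<union> {(1 - 2 * \<rho>) / 2<..<(1 - \<rho>) / 2}"
        then have lam: "lam \<in> {0<..<1 - \<rho>}" by (rule sub)
        show "hausdorff_dim (unique_coding_set \<rho> lam) = hausdorff_dim (self_similar_set \<rho> lam) \<and>
            hausdorff_dim (self_similar_set \<rho> lam) = ennreal (ln 4 / (- ln \<rho>))"
          \<comment> \<open>The dimensions of the unique-coding set and of the attractor are
            squeezed between the almost sure lower bound and the covering upper bound.\<close>
          using elim lam hausdorff_dim_mono[OF U[of lam]]
            hausdorff_dim_self_similar_subset_le[OF lam order_refl]
          by (meson order.antisym order.trans)
      qed
    qed
  next
    assume "\<rho> < 1/16"
    then have "AE lam in lebesgue. lam \<in> {0<..<1 - \<rho>} \<longrightarrow> inj (point \<rho> lam)"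
      by (intro AE_completion AE_parameter_inj)
    then show "AE lam\<in>{0<..<\<rho>} \<union> {(1 - 2 * \<rho>) / 2<..<(1 - \<rho>) / 2} in lebesgue.
        unique_coding_set \<rho> lam = self_similar_set \<rho> lam"
    proof eventually_elim
      case (elim lam)
      show ?case
      proof
        assume "lam \<in> {0<..<\<rho>} \<union> {(1 - 2 * \<rho>) / 2<..<(1 - \<rho>) / 2}"
        then have lam: "lam \<in> {0<..<1 - \<rho>}" by (rule sub)
        with elim have "inj (point \<rho> lam)" by blast
        \<comment> \<open>Injectivity on symbol sequences makes every coded point one with a unique
          coding.\<close>
        then have "point \<rho> lam w \<in> unique_coding_set \<rho> lam" for w
          by (intro unique_codingI[OF lam]) (rule injD)
        then have "self_similar_set \<rho> lam \<subseteq> unique_coding_set \<rho> lam"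
          unfolding self_similar_set_eq_range_point[OF lam] by blast
        with U show "unique_coding_set \<rho> lam = self_similar_set \<rho> lam" by blast
      qed
    qed
  qed
qed

end
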